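(* Let $E_1,E_2,\dots$ be independent standard exponential random variables, let $\gamma>0$, let $f$ be an increasing real-valued function of the integer $j\ge 0$ with $f(0)=0$, put $\Delta f(j)=f(j)-f(j-1)$ for $j\ge1$, and let $(\alpha(k))_{k\ge1}$ be a sequence of positive real numbers. Define $$S_k^{*}=\sum_{j=1}^{k-1}\Delta f(j)\left[\exp\left(-\gamma\sum_{h=j}^{k-1}\frac{E_h}{h}\right)-\mathbb{E}\exp\left(-\gamma\sum_{h=j}^{k-1}\frac{E_h}{h}\right)\right]\alpha(k).$$ Suppose that for some $\delta$, $0<\delta<3$, with $\nu=(1-\delta)/2$, the following conditions hold for $L$ and $q$ large enough such that $L\le q^2$: $$\sup_{k\ge L}\frac{\alpha^2(k)}{k^{2\gamma+1+\nu}}\sum_{j=L}^{k-1}(\Delta f(j))^2 j^{2\gamma}<+\infty,$$ $$\sup_{k\ge L}\frac{\alpha^2(k)}{k^{1+\nu}}\sum_{j=L+1}^{k-1}\left[\sum_{i=L}^{j-1}\Delta f(i)\right]\Delta f(j)\frac1j<+\infty,$$ $$\sup_{k\ge L}\frac{\alpha^2(k)}{k^{1+\nu}}\sum_{j=L}^{k-1}\frac{\Delta f(j)}{j}<+\infty,$$ $$\sup_{k,q}\ \frac{1}{q^{3-\delta}}\sum_{i=1}^{2q+1}\alpha^2(k)(\Delta f(q^2+i))^2\left(\frac{q^2+i}{k}\right)^{2\gamma}<+\infty,$$ $$\sup_{k,q}\ \frac{\alpha^2(k)}{q^{3-\delta}}\sum_{j=2}^{2q+1}\left[\sum_{i=1}^{j-1}\Delta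 f(q^2+i)\right]\Delta f(q^2+j)\frac{1}{q^2+j}<+\infty,$$ where in the last two conditions the supremum is over integers $k\ge1$ and (large enough, $q^2\ge L$) integers $q$ with $q^2+1\le k\le (q+1)^2$. Then $$\frac{S_k^{*}}{k}\to 0\quad\text{almost surely as }k\to+\infty.$$ Further, if, with $$\mu_k=\sum_{j=1}^{k-1}\alpha(k)\Delta f(j)\,\mathbb{E}\exp\left(-\gamma\sum_{h=j}^{k-1}\frac{E_h}{h}\right),$$ one has $k^{-1}\mu_k\to\mu$ as $k\to+\infty$ for some finite $\mu$, then $$k^{-1}\sum_{j=1}^{k-1}\alpha(k)\Delta f(j)\exp\left(-\gamma\sum_{h=j}^{k-1}\frac{E_h}{h}\right)\to\mu\quad\text{almost surely as }k\to+\infty.$$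
   Context: All indices $j,i,h,k,q,L$ are integers. "For $L$ and $q$ large enough such that $L\le q^2$" means that $L$ is a sufficiently large fixed integer, and $q$ ranges over sufficiently large integers with $q^2\ge L$. Empty sums are $0$. *)

theory Defs
  imports "HOL-Probability.Probability"
begin

text \<open>Meant for \<open>j \<ge> 1\<close>; at \<open>j = 0\<close> truncated subtraction makes it \<open>0\<close>.\<close>

definition increment :: "(nat \<Rightarrow> real) \<Rightarrow> nat \<Rightarrow> real" where
  "increment f j = f j - f (j - 1)"

definition exp_factor :: "(nat \<Rightarrow> 'a \<Rightarrow> real) \<Rightarrow> real \<Rightarrow> nat \<Rightarrow> nat \<Rightarrow> 'a \<Rightarrow> real" where
  "exp_factor E \<gamma> j k \<omega> = exp (- \<gamma> * (\<Sum>h = j..<k. E h \<omega> / real h))"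

definition S_star ::
    "'a measure \<Rightarrow> (nat \<Rightarrow> 'a \<Rightarrow> real) \<Rightarrow> real \<Rightarrow> (nat \<Rightarrow> real) \<Rightarrow> (nat \<Rightarrow> real) \<Rightarrow> nat \<Rightarrow> 'a \<Rightarrow> real" where
  "S_star M E \<gamma> f \<alpha> k \<omega> =
     (\<Sum>j = 1..<k. increment f j *
        (exp_factor E \<gamma> j k \<omega> - prob_space.expectation M (exp_factor E \<gamma> j k)) * \<alpha> k)"

definition mu_seq ::
    "'a measure \<Rightarrow> (nat \<Rightarrow> 'a \<Rightarrow> real) \<Rightarrow> real \<Rightarrow> (nat \<Rightarrow> real) \<Rightarrow> (nat \<Rightarrow> real) \<Rightarrow> nat \<Rightarrow> real" where
  "mu_seq M E \<gamma> f \<alpha> k =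
     (\<Sum>j = 1..<k. \<alpha> k * increment f j * prob_space.expectation M (exp_factor E \<gamma> j k))"

text \<open>\<open>k\<close> lies in the block between consecutive squares \<open>q\<^sup>2\<close> and \<open>(q + 1)\<^sup>2\<close>; \<open>q0\<close> is the threshold
  expressing that \<open>q\<close> is large enough.\<close>

definition block_pairs :: "nat \<Rightarrow> nat \<Rightarrow> (nat \<times> nat) set" where
  "block_pairs L q0 = {(k, q). q0 \<le> q \<and> L \<le> q\<^sup>2 \<and> q\<^sup>2 + 1 \<le> k \<and> k \<le> (q + 1)\<^sup>2}"

end

theory Submission imports Defs "HOL-Library.Discrete_Functions" begin

text \<open>
  Write \<open>W j k = exp_factor E \<gamma> j k\<close> and let \<open>d = increment f\<close>, so that \<open>S_star\<close> is \<open>\<alpha> k\<close> times the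
  centred sum \<open>D k = (\<Sum>j = 1..<k. d j * (W j k - \<bbbE> (W j k)))\<close>. The exponents telescope, whence
  \<open>W j (k + 1) = W j k * e k\<close> with \<open>e k = exp (- \<gamma> * E k / k)\<close> independent of the past. Therefore
  \<open>D (k + 1) = e k * D k + a k * (e k - \<bbbE> (e k))\<close>, where \<open>a k = (\<Sum>j = 1..k. d j * \<bbbE> (W j k))\<close> is the
  deterministic drift: a contracting linear recursion driven by independent centred noise whose
  variance is at most \<open>\<gamma>\<^sup>2 / k\<^sup>2\<close>. Second moments of such a recursion add up along the way
  (\<open>noise_sum_moments\<close>), and this holds from whatever time \<open>n\<close> it is started
  (\<open>centred_sum_restart\<close>): \<open>D k = W n k * D n + R n k\<close>, where \<open>R n k\<close> only collects the noise
  between \<open>n\<close> and \<open>k\<close>.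

  Second moments cannot be summed over all \<open>k\<close> when \<open>\<delta> \<le> 1\<close>: they give \<open>\<alpha>\<^sup>2 \<bbbE> (D k)\<^sup>2 / k\<^sup>2\<close> of order
  \<open>k powr (- (1 + \<delta>) / 2)\<close>. They suffice along the squares \<open>n = q\<^sup>2\<close>, where the order becomes
  \<open>q powr (- 1 - \<delta>)\<close>. For \<open>k\<close> between \<open>q\<^sup>2\<close> and \<open>(q + 1)\<^sup>2\<close> the recursion is restarted at \<open>q\<^sup>2\<close>. Almost
  surely \<open>W n k \<le> 1\<close>, so the old part is controlled by the single random variable \<open>D n\<close>, uniformly
  in the block. The fresh noise \<open>R n k\<close> comes from at most \<open>2 * q + 1\<close> steps, so its scaled second
  moment is so small that it can be summed over the \<open>2 * q + 1\<close> indices of the block, again with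
  total order \<open>q powr (- 1 - \<delta>)\<close>. Summability over \<open>q\<close> gives almost sure convergence.

  What remains is deterministic (\<open>scaled_noise_bounds\<close>): the growth hypotheses bound
  \<open>\<alpha>\<^sup>2 (\<Sum>h<k. (a h)\<^sup>2 / h\<^sup>2 * (h / k) powr (2 * \<gamma>))\<close> and \<open>\<alpha>\<^sup>2 (a h)\<^sup>2\<close>. Since \<open>\<bbbE> (W j k)\<close> is at most a constant
  times \<open>(j / k) powr \<gamma>\<close>, the drift is at most a constant times \<open>c (h + 1) / h powr \<gamma>\<close> with the power sums
  \<open>c h = (\<Sum>j<h. d j * j powr \<gamma>)\<close>. One summation by parts bounds both quantities by
  \<open>(\<Sum>j. ((c (j + 1))\<^sup>2 - (c j)\<^sup>2) / j)\<close>, and expanding the square splits this into a diagonal and an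
  off-diagonal double sum over the increments, which are the sums in the first two growth
  hypotheses.
\<close>

section \<open>Sums of inverse squares and products of ratios\<close>

lemma inverse_square_le_telescope:
  "1 \<le> k \<Longrightarrow> 1 / (real k)\<^sup>2 \<le> 2 / real k - 2 / real (Suc k)"
proof -
  assume k: "1 \<le> k"
  then have "1 / (real k)\<^sup>2 = (1 / real k) * (1 / real k)"
    by (simp add: power2_eq_square)
  also have "\<dots> \<le> (1 / real k) * (2 / real (Suc k))"
    using k by (intro mult_left_mono) (auto simp: field_simps)
  also have "\<dots> = 2 / real k - 2 / real (Suc k)"
    using k by (simp add: field_simps)
  finally show ?thesis .
qed

lemma sum_inverse_squares_le:
  assumes "1 \<le> j" "j \<le> k"
  shows "(\<Sum>h = j..<k. 1 / (real h)\<^sup>2) \<le> 2 / real j - 2 / real k"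
  using assms(2)
proof (induction k rule: dec_induct)
  case base
  then show ?case by simp
next
  case (step k)
  have "1 / (real k)\<^sup>2 \<le> 2 / real k - 2 / real (Suc k)"
    using assms(1) step.hyps by (intro inverse_square_le_telescope) simp
  then show ?case using step by simp
qed

text \<open>
  One step of the comparison of \<open>\<Prod>l. 1 / (1 + c / l)\<close> with a power: both factors are \<open>exp (- c / l)\<close>
  up to an error of relative size \<open>c\<^sup>2 / l\<^sup>2\<close>, which is summable in \<open>l\<close>.
\<close>

lemma inverse_le_powr_ratio:
  fixes c :: real
  assumes "c > 0" "1 \<le> l"
  shows "1 / (1 + c / real l) \<le> exp (c\<^sup>2 / (real l)\<^sup>2) * (real l / real (Suc l)) powr c"
proof -
  define x where "x = c / real l"
  have x: "x > 0" using assms by (simp add: x_def)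
  have low: "x - x\<^sup>2 \<le> ln (1 + x)"
  proof (cases "x \<le> 1")
    case True
    then show ?thesis using x by (intro ln_one_plus_pos_lower_bound) auto
  next
    case False
    then have "x - x\<^sup>2 \<le> 0" by (simp add: power2_eq_square)
    also have "0 \<le> ln (1 + x)" using x by simp
    finally show ?thesis .
  qed
  have "ln (real (Suc l) / real l) = ln (1 + 1 / real l)"
    using assms by (simp add: field_simps)
  also have "\<dots> \<le> 1 / real l" by (intro ln_add_one_self_le_self) auto
  finally have "c * ln (real (Suc l) / real l) \<le> x"
    using assms by (simp add: x_def field_simps)
  moreover have "ln (real l / real (Suc l)) = - ln (real (Suc l) / real l)"
    using assms by (simp add: ln_div)
  ultimately have "- ln (1 + x) \<le> x\<^sup>2 + c * ln (real l / real (Suc l))"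
    using low by simp
  then have "exp (- ln (1 + x)) \<le> exp (x\<^sup>2 + c * ln (real l / real (Suc l)))"
    by simp
  also have "\<dots> = exp (c\<^sup>2 / (real l)\<^sup>2) * (real l / real (Suc l)) powr c"
    using assms by (simp add: exp_add powr_def x_def power_divide)
  also have "exp (- ln (1 + x)) = 1 / (1 + x)"
    using x by (simp add: exp_minus field_simps)
  finally show ?thesis by (simp add: x_def)
qed

lemma prod_inverse_le_powr_ratio:
  fixes c :: real
  assumes "c > 0" "1 \<le> j" "j \<le> k"
  shows "(\<Prod>l = j..<k. 1 / (1 + c / real l)) \<le> exp (2 * c\<^sup>2) * (real j / real k) powr c"
proof -
  have "(\<Prod>l = j..<k. 1 / (1 + c / real l))
      \<le> (\<Prod>l = j..<k. exp (c\<^sup>2 / (real l)\<^sup>2) * (real l / real (Suc l)) powr c)"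
    using assms by (intro prod_mono conjI inverse_le_powr_ratio) auto
  also have "\<dots> = exp (\<Sum>l = j..<k. c\<^sup>2 / (real l)\<^sup>2) * (\<Prod>l = j..<k. (real l / real (Suc l)) powr c)"
    by (simp add: prod.distrib exp_sum)
  also have "(\<Prod>l = j..<k. (real l / real (Suc l)) powr c) = (real j / real k) powr c"
    using assms(3)
  proof (induction k rule: dec_induct)
    case base
    then show ?case using assms by simp
  next
    case (step k)
    then show ?case using assms by (simp flip: powr_mult)
  qed
  also have "(\<Sum>l = j..<k. c\<^sup>2 / (real l)\<^sup>2) = c\<^sup>2 * (\<Sum>l = j..<k. 1 / (real l)\<^sup>2)"
    by (simp add: sum_distrib_left)
  also have "exp (c\<^sup>2 * (\<Sum>l = j..<k. 1 / (real l)\<^sup>2)) \<le> exp (2 * c\<^sup>2)"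
  proof -
    have "(\<Sum>l = j..<k. 1 / (real l)\<^sup>2) \<le> 2 / real j - 2 / real k"
      by (rule sum_inverse_squares_le) (use assms in auto)
    also have "\<dots> \<le> 2 / real j" by simp
    also have "\<dots> \<le> 2" using assms by (simp add: field_simps)
    finally have "c\<^sup>2 * (\<Sum>l = j..<k. 1 / (real l)\<^sup>2) \<le> c\<^sup>2 * 2" by (rule mult_left_mono) simp
    then show ?thesis by (simp add: mult.commute)
  qed
  finally show ?thesis by (simp add: mult_right_mono)
qed

text \<open>
  Summation by parts, with \<open>1 / h\<^sup>2 \<le> 2 * (1 / h - 1 / (h + 1))\<close> in place of the first factor. The
  boundary term is kept because it bounds \<open>(c k)\<^sup>2\<close> itself by \<open>k\<close> times the same right-hand side.
\<close>

lemma sum_squares_le_weighted_increments: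
  fixes c :: "nat \<Rightarrow> real"
  assumes "1 \<le> L" "L \<le> k" "c L = 0"
  shows "(\<Sum>h = L..<k. (c (Suc h))\<^sup>2 / (real h)\<^sup>2) + 2 * (c k)\<^sup>2 / real k
    \<le> 2 * (\<Sum>j = L..<k. ((c (Suc j))\<^sup>2 - (c j)\<^sup>2) / real j)"
  using assms(2)
proof (induction k rule: dec_induct)
  case base
  then show ?case using assms by simp
next
  case (step k)
  have k: "real k \<ge> 1" using assms step.hyps by simp
  have "1 / (real k)\<^sup>2 + 2 / real (Suc k) \<le> 2 / real k"
    using k inverse_square_le_telescope[of k] by simp
  then have "(c (Suc k))\<^sup>2 * (1 / (real k)\<^sup>2 + 2 / real (Suc k)) \<le> (c (Suc k))\<^sup>2 * (2 / real k)"
    by (rule mult_left_mono) simp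
  then have "(c (Suc k))\<^sup>2 / (real k)\<^sup>2 + 2 * (c (Suc k))\<^sup>2 / real (Suc k)
     \<le> 2 * (((c (Suc k))\<^sup>2 - (c k)\<^sup>2) / real k) + 2 * (c k)\<^sup>2 / real k"
    by (simp add: algebra_simps diff_divide_distrib)
  then show ?case using step by (simp add: algebra_simps)
qed

section \<open>Almost sure convergence along blocks\<close>

text \<open>
  The expected sum is finite, so the sum is finite almost surely and its terms vanish. The
  hypotheses start at \<open>N\<close> only, as the bounds on a block are available only for large blocks.
\<close>

lemma (in prob_space) AE_tendsto_0_if_summable_nn_integral:
  fixes Y :: "nat \<Rightarrow> 'a \<Rightarrow> real" and u :: "nat \<Rightarrow> real"
  assumes meas: "\<And>q. q \<ge> N \<Longrightarrow> Y q \<in> borel_measurable M"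
    and pos: "\<And>q \<omega>. q \<ge> N \<Longrightarrow> 0 \<le> Y q \<omega>"
    and le: "\<And>q. q \<ge> N \<Longrightarrow> (\<integral>\<^sup>+\<omega>. ennreal (Y q \<omega>) \<partial>M) \<le> ennreal (u q)"
    and u: "summable u" "\<And>q. 0 \<le> u q"
  shows "AE \<omega> in M. (\<lambda>q. Y q \<omega>) \<longlonglongrightarrow> 0"
proof -
  have [measurable]: "Y (q + N) \<in> borel_measurable M" for q
    by (rule meas) simp
  have "(\<integral>\<^sup>+\<omega>. (\<Sum>q. ennreal (Y (q + N) \<omega>)) \<partial>M) = (\<Sum>q. \<integral>\<^sup>+\<omega>. ennreal (Y (q + N) \<omega>) \<partial>M)"
    by (rule nn_integral_suminf) simp
  also have "\<dots> \<le> (\<Sum>q. ennreal (u (q + N)))"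
    by (intro suminf_le le) auto
  also have "\<dots> = ennreal (\<Sum>q. u (q + N))"
    using u by (intro suminf_ennreal2) (auto simp: summable_iff_shift)
  finally have "(\<integral>\<^sup>+\<omega>. (\<Sum>q. ennreal (Y (q + N) \<omega>)) \<partial>M) \<noteq> \<infinity>"
    by (auto simp: top_unique)
  then have "AE \<omega> in M. (\<Sum>q. ennreal (Y (q + N) \<omega>)) \<noteq> \<infinity>"
    by (intro nn_integral_PInf_AE) auto
  then show ?thesis
  proof eventually_elim
    case (elim \<omega>)
    then have "summable (\<lambda>q. Y (q + N) \<omega>)"
      by (intro summable_suminf_not_top pos) auto
    then show ?case
      using summable_LIMSEQ_zero summable_iff_shift by blast
  qed
qed

lemma tendsto_0_if_blockwise_le:
  fixes X Y :: "nat \<Rightarrow> real"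
  assumes Y: "Y \<longlonglongrightarrow> 0"
    and le: "\<And>q k. q \<ge> N \<Longrightarrow> q\<^sup>2 < k \<Longrightarrow> k \<le> (q + 1)\<^sup>2 \<Longrightarrow> (X k)\<^sup>2 \<le> Y q"
  shows "X \<longlonglongrightarrow> 0"
proof -
  \<comment> \<open>The block containing \<open>k\<close>: \<open>q\<^sup>2 < k \<le> (q + 1)\<^sup>2\<close> means \<open>q = floor_sqrt (k - 1)\<close>.\<close>
  have lim: "filterlim (\<lambda>k. floor_sqrt (k - 1)) at_top sequentially"
    unfolding filterlim_at_top eventually_sequentially
  proof (intro allI exI impI)
    fix Z k :: nat
    assume "k \<ge> Z\<^sup>2 + 1"
    then show "Z \<le> floor_sqrt (k - 1)" by (intro le_floor_sqrtI) simp
  qed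
  have ev: "eventually (\<lambda>k. floor_sqrt (k - 1) \<ge> N) sequentially"
    using lim by (simp add: filterlim_at_top)
  have "(\<lambda>k. (X k)\<^sup>2) \<longlonglongrightarrow> 0"
  proof (rule tendsto_sandwich[OF _ _ tendsto_const filterlim_compose[OF Y lim]])
    show "eventually (\<lambda>k. (X k)\<^sup>2 \<le> Y (floor_sqrt (k - 1))) sequentially"
      using ev eventually_ge_at_top[of 1]
    proof eventually_elim
      case (elim k)
      have "(floor_sqrt (k - 1))\<^sup>2 < k"
        using elim floor_sqrt_power2_le[of "k - 1"] by linarith
      moreover have "k \<le> (floor_sqrt (k - 1) + 1)\<^sup>2"
        using Suc_floor_sqrt_power2_gt[of "k - 1"] by simp
      ultimately show ?case using elim le by blast
    qed
  qed auto
  then show ?thesis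
    using tendsto_real_sqrt[of "\<lambda>k. (X k)\<^sup>2" 0 sequentially] by (simp add: tendsto_rabs_zero_iff)
qed

section \<open>The noise recursion\<close>

lemma exp_factor_Suc:
  "j \<le> k \<Longrightarrow> exp_factor E \<gamma> j (Suc k) \<omega> = exp_factor E \<gamma> j k \<omega> * exp_factor E \<gamma> k (Suc k) \<omega>"
  by (simp add: exp_factor_def distrib_left flip: exp_add)

lemma exp_factor_self [simp]: "exp_factor E \<gamma> k k \<omega> = 1"
  by (simp add: exp_factor_def)

text \<open>
  The recursion satisfied by the centred sums, started with value \<open>0\<close> at time \<open>n\<close> and with an
  arbitrary sequence \<open>a\<close> in place of the drift. It is a function of the path \<open>x\<close> of the exponential
  variables, rather than of the sample point, so that its dependence on \<open>x n, \<dots>, x (k - 1)\<close> alone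
  can be expressed through measurability on a product space.
\<close>

primrec noise_sum :: "real \<Rightarrow> (nat \<Rightarrow> real) \<Rightarrow> nat \<Rightarrow> nat \<Rightarrow> (nat \<Rightarrow> real) \<Rightarrow> real" where
  "noise_sum \<gamma> a n 0 x = 0"
| "noise_sum \<gamma> a n (Suc k) x = (if k < n then 0
     else exp_factor (\<lambda>h x. x h) \<gamma> k (Suc k) x * noise_sum \<gamma> a n k x
        + a k * (exp_factor (\<lambda>h x. x h) \<gamma> k (Suc k) x - 1 / (1 + \<gamma> / real k)))"

lemma noise_sum_eq_0: "k \<le> n \<Longrightarrow> noise_sum \<gamma> a n k x = 0"
  by (cases k) auto

lemma noise_sum_cong:
  "(\<And>h. h \<in> {n..<k} \<Longrightarrow> x h = y h) \<Longrightarrow> noise_sum \<gamma> a n k x = noise_sum \<gamma> a n k y"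
  by (induction k) (auto simp: exp_factor_def)

lemma measurable_noise_sum:
  "{n..<k} \<subseteq> A \<Longrightarrow> noise_sum \<gamma> a n k \<in> borel_measurable (PiM A (\<lambda>_. borel))"
proof (induction k)
  case 0
  then show ?case by simp
next
  case (Suc k)
  show ?case
  proof (cases "k < n")
    case True
    then show ?thesis by simp
  next
    case False
    then have [measurable]: "k \<in> A" using Suc.prems by auto
    have [measurable]: "noise_sum \<gamma> a n k \<in> borel_measurable (PiM A (\<lambda>_. borel))"
      using Suc by fastforce
    have [measurable]: "(\<lambda>x. x k) \<in> borel_measurable (PiM A (\<lambda>_. borel :: real measure))"
      by (rule measurable_component_singleton) fact
    show ?thesis using False by (simp add: exp_factor_def)
  qed
qed

section \<open>Moments of the accumulated noise\<close>

locale exponential_sequence = prob_space M for M :: "'a measure" +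
  fixes E :: "nat \<Rightarrow> 'a \<Rightarrow> real" and \<gamma> :: real
  assumes indep: "indep_vars (\<lambda>_. borel) E {1..}"
    and distr: "\<And>h. h \<ge> 1 \<Longrightarrow> distributed M lborel (E h) (exponential_density 1)"
    and \<gamma>_pos: "\<gamma> > 0"
begin

text \<open>
  Tilting by \<open>exp (- c x)\<close> turns the exponential density of rate \<open>1\<close> into \<open>1 / (1 + c)\<close> times the
  exponential density of rate \<open>1 + c\<close>.
\<close>

lemma laplace_transform:
  assumes "c > 0" "h \<ge> 1"
  shows "integrable M (\<lambda>\<omega>. exp (- c * E h \<omega>))" (is ?I)
    and "expectation (\<lambda>\<omega>. exp (- c * E h \<omega>)) = 1 / (1 + c)" (is ?E)
proof -
  interpret D: prob_space "density lborel (exponential_density (1 + c))"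
    by (rule prob_space_exponential_density) (use assms in simp)
  have nn: "0 \<le> exponential_density (1 + c) x" for x
    using assms by (intro exponential_density_nonneg) simp
  have int1: "integrable lborel (exponential_density (1 + c))"
    using D.integrable_const[of "1::real"] nn
      integrable_real_density[of "exponential_density (1 + c)" lborel "\<lambda>_. 1::real"] by simp
  have int2: "(\<integral>x. exponential_density (1 + c) x \<partial>lborel) = 1"
    using integral_real_density[of "exponential_density (1 + c)" lborel "\<lambda>_. 1"] nn D.prob_space
    by simp
  have eq: "(\<lambda>x. exponential_density 1 x * exp (- c * x)) = (\<lambda>x. exponential_density (1 + c) x * (1 / (1 + c)))"
  proof
    fix x :: real
    have "exp (- x) * exp (- c * x) = exp (- x * (1 + c))"
      by (simp add: algebra_simps flip: exp_add)
    then show "exponential_density 1 x * exp (- c * x) = exponential_density (1 + c) x * (1 / (1 + c))"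
      using assms by (simp add: exponential_density_def)
  qed
  have nn1: "0 \<le> exponential_density 1 x" for x by (rule exponential_density_nonneg) simp
  have "integrable lborel (\<lambda>x. exponential_density 1 x * exp (- c * x))"
    unfolding eq using int1 by simp
  then show ?I
    using distributed_integrable[OF distr[OF assms(2)], of "\<lambda>x. exp (- c * x)"] nn1 by simp
  have "(\<integral>x. exponential_density 1 x * exp (- c * x) \<partial>lborel) = 1 / (1 + c)"
    unfolding eq by (subst integral_mult_left_zero) (simp add: int2)
  then show ?E
    using distributed_integral[OF distr[OF assms(2)], of "\<lambda>x. exp (- c * x)"] nn1 by simp
qed

lemma one_step_moments:
  assumes "k \<ge> 1"
  shows "integrable M (exp_factor E \<gamma> k (Suc k))"
    and "expectation (exp_factor E \<gamma> k (Suc k)) = 1 / (1 + \<gamma> / real k)"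
    and "integrable M (\<lambda>\<omega>. (exp_factor E \<gamma> k (Suc k) \<omega>)\<^sup>2)"
    and "expectation (\<lambda>\<omega>. (exp_factor E \<gamma> k (Suc k) \<omega>)\<^sup>2) = 1 / (1 + 2 * \<gamma> / real k)"
proof -
  have 1: "exp_factor E \<gamma> k (Suc k) = (\<lambda>\<omega>. exp (- (\<gamma> / real k) * E k \<omega>))"
    by (simp add: exp_factor_def fun_eq_iff)
  have 2: "(\<lambda>\<omega>. (exp_factor E \<gamma> k (Suc k) \<omega>)\<^sup>2) = (\<lambda>\<omega>. exp (- (2 * \<gamma> / real k) * E k \<omega>))"
    by (simp add: exp_factor_def fun_eq_iff power2_eq_square flip: exp_add)
  show "integrable M (exp_factor E \<gamma> k (Suc k))"
    unfolding 1 by (rule laplace_transform) (use assms \<gamma>_pos in auto)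
  show "expectation (exp_factor E \<gamma> k (Suc k)) = 1 / (1 + \<gamma> / real k)"
    unfolding 1 by (rule laplace_transform) (use assms \<gamma>_pos in auto)
  show "integrable M (\<lambda>\<omega>. (exp_factor E \<gamma> k (Suc k) \<omega>)\<^sup>2)"
    unfolding 2 by (rule laplace_transform) (use assms \<gamma>_pos in auto)
  show "expectation (\<lambda>\<omega>. (exp_factor E \<gamma> k (Suc k) \<omega>)\<^sup>2) = 1 / (1 + 2 * \<gamma> / real k)"
    unfolding 2 by (rule laplace_transform) (use assms \<gamma>_pos in auto)
qed

lemma expectation_exp_factor:
  assumes "1 \<le> j"
  shows "expectation (exp_factor E \<gamma> j k) = (\<Prod>l = j..<k. 1 / (1 + \<gamma> / real l))"
proof (cases "j < k")
  case True
  have ind: "indep_vars (\<lambda>_. borel) (\<lambda>l. exp_factor E \<gamma> l (Suc l)) {j..<k}"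
  proof -
    have "indep_vars (\<lambda>_. borel) (\<lambda>l. (\<lambda>x. exp (- \<gamma> * (x / real l))) \<circ> E l) {j..<k}"
      by (rule indep_vars_compose[OF indep_vars_subset[OF indep]]) (use assms in auto)
    then show ?thesis by (simp add: exp_factor_def[abs_def] comp_def)
  qed
  have "exp_factor E \<gamma> j k = (\<lambda>\<omega>. \<Prod>l = j..<k. exp_factor E \<gamma> l (Suc l) \<omega>)"
    by (simp add: exp_factor_def fun_eq_iff exp_sum sum_distrib_left flip: sum_negf)
  then have "expectation (exp_factor E \<gamma> j k)
      = expectation (\<lambda>\<omega>. \<Prod>l = j..<k. exp_factor E \<gamma> l (Suc l) \<omega>)"
    by simp
  also have "\<dots> = (\<Prod>l = j..<k. expectation (exp_factor E \<gamma> l (Suc l)))"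
    using assms by (intro indep_vars_lebesgue_integral[OF _ ind] one_step_moments) auto
  also have "\<dots> = (\<Prod>l = j..<k. 1 / (1 + \<gamma> / real l))"
    using assms by (intro prod.cong refl one_step_moments) auto
  finally show ?thesis .
next
  case False
  then have "exp_factor E \<gamma> j k = (\<lambda>_. 1)" by (auto simp: exp_factor_def)
  then show ?thesis using False by (simp add: prob_space)
qed

text \<open>
  Only almost sure, because the variables are nonnegative only up to a null set.
\<close>

lemma AE_exp_factor_le_1: "AE \<omega> in M. \<forall>j k. 1 \<le> j \<longrightarrow> exp_factor E \<gamma> j k \<omega> \<le> 1"
proof -
  have "AE \<omega> in M. \<forall>h. h \<ge> 1 \<longrightarrow> 0 \<le> E h \<omega>"
    unfolding AE_all_countable
  proof
    fix h
    show "AE \<omega> in M. h \<ge> 1 \<longrightarrow> 0 \<le> E h \<omega>"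
    proof (cases "h \<ge> 1")
      case True
      have "AE x in density lborel (exponential_density 1). (0::real) \<le> x"
        by (subst AE_density) (auto simp: exponential_density_def)
      then have "AE x in distr M lborel (E h). 0 \<le> x"
        by (subst distributed_distr_eq_density[OF distr[OF True]])
      then show ?thesis
        using AE_distrD[OF distributed_measurable[OF distr[OF True]]] by auto
    qed simp
  qed
  then show ?thesis
  proof eventually_elim
    case (elim \<omega>)
    show ?case
      using elim \<gamma>_pos by (auto simp: exp_factor_def intro!: mult_nonneg_nonneg sum_nonneg)
  qed
qed

lemma indep_noise_sum_next_factor:
  assumes "1 \<le> n" "n \<le> k"
  shows "indep_var borel (\<lambda>\<omega>. noise_sum \<gamma> a n k (\<lambda>h. E h \<omega>)) borel (exp_factor E \<gamma> k (Suc k))"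
proof -
  have "indep_var borel (noise_sum \<gamma> a n k \<circ> (\<lambda>\<omega>. restrict (\<lambda>i. E i \<omega>) {n..<k}))
      borel ((\<lambda>x. exp (- \<gamma> * (x k / real k))) \<circ> (\<lambda>\<omega>. restrict (\<lambda>i. E i \<omega>) {k}))"
    by (rule indep_var_compose[OF indep_var_restrict[OF indep] measurable_noise_sum])
       (use assms in auto)
  also have "noise_sum \<gamma> a n k \<circ> (\<lambda>\<omega>. restrict (\<lambda>i. E i \<omega>) {n..<k})
      = (\<lambda>\<omega>. noise_sum \<gamma> a n k (\<lambda>h. E h \<omega>))"
    by (auto simp: fun_eq_iff intro!: noise_sum_cong)
  also have "(\<lambda>x. exp (- \<gamma> * (x k / real k))) \<circ> (\<lambda>\<omega>. restrict (\<lambda>i. E i \<omega>) {k})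
      = exp_factor E \<gamma> k (Suc k)"
    by (auto simp: fun_eq_iff exp_factor_def)
  finally show ?thesis .
qed

text \<open>
  The noise of step \<open>h\<close> has variance at most \<open>\<gamma>\<^sup>2 * (a h)\<^sup>2 / h\<^sup>2\<close>, and each later step \<open>l\<close> multiplies
  second moments by the mean square \<open>1 / (1 + 2 * \<gamma> / l)\<close> of its contraction factor.
\<close>

definition noise_bound :: "(nat \<Rightarrow> real) \<Rightarrow> nat \<Rightarrow> nat \<Rightarrow> real" where
  "noise_bound a n k =
     (\<Sum>h = n..<k. \<gamma>\<^sup>2 * (a h)\<^sup>2 / (real h)\<^sup>2 * (\<Prod>l = Suc h..<k. 1 / (1 + 2 * \<gamma> / real l)))"

lemma noise_bound_Suc:
  assumes "n \<le> k"
  shows "noise_bound a n (Suc k)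
    = noise_bound a n k * (1 / (1 + 2 * \<gamma> / real k)) + (a k)\<^sup>2 * (\<gamma>\<^sup>2 / (real k)\<^sup>2)"
proof -
  have "noise_bound a n (Suc k) = (\<Sum>h = n..<k. \<gamma>\<^sup>2 * (a h)\<^sup>2 / (real h)\<^sup>2 *
      (\<Prod>l = Suc h..<Suc k. 1 / (1 + 2 * \<gamma> / real l))) + (a k)\<^sup>2 * (\<gamma>\<^sup>2 / (real k)\<^sup>2)"
    using assms unfolding noise_bound_def by (subst sum.atLeastLessThan_Suc) (auto simp: mult.commute)
  also have "(\<Sum>h = n..<k. \<gamma>\<^sup>2 * (a h)\<^sup>2 / (real h)\<^sup>2 *
      (\<Prod>l = Suc h..<Suc k. 1 / (1 + 2 * \<gamma> / real l)))
    = (\<Sum>h = n..<k. \<gamma>\<^sup>2 * (a h)\<^sup>2 / (real h)\<^sup>2 *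
      (\<Prod>l = Suc h..<k. 1 / (1 + 2 * \<gamma> / real l)) * (1 / (1 + 2 * \<gamma> / real k)))"
    by (intro sum.cong refl) (simp add: prod.atLeastLessThan_Suc mult.assoc)
  also have "\<dots> = noise_bound a n k * (1 / (1 + 2 * \<gamma> / real k))"
    unfolding noise_bound_def by (rule sum_distrib_right[symmetric])
  finally show ?thesis .
qed

lemma one_step_variance_le:
  assumes "k \<ge> 1"
  shows "1 / (1 + 2 * \<gamma> / real k) - (1 / (1 + \<gamma> / real k))\<^sup>2 \<le> \<gamma>\<^sup>2 / (real k)\<^sup>2"
proof -
  define x where "x = \<gamma> / real k"
  have x: "x > 0" using assms \<gamma>_pos by (simp add: x_def)
  have "1 / (1 + 2 * x) - (1 / (1 + x))\<^sup>2 = x\<^sup>2 / ((1 + 2 * x) * (1 + x)\<^sup>2)"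
  proof -
    have "(1 + x)\<^sup>2 = 1 + 2 * x + x\<^sup>2" by (simp add: power2_eq_square algebra_simps)
    moreover have "1 / (1 + 2 * x) - 1 / (1 + x)\<^sup>2 = ((1 + x)\<^sup>2 - (1 + 2 * x)) / ((1 + 2 * x) * (1 + x)\<^sup>2)"
      using x by (subst diff_frac_eq) auto
    ultimately show ?thesis by (simp add: power_one_over)
  qed
  also have "\<dots> \<le> x\<^sup>2 / 1"
  proof (rule divide_left_mono)
    have "1 * 1 \<le> (1 + 2 * x) * (1 + x)\<^sup>2"
      using x by (intro mult_mono one_le_power) auto
    then show "1 \<le> (1 + 2 * x) * (1 + x)\<^sup>2" by simp
  qed (use x in auto)
  finally show ?thesis by (simp add: x_def power_divide)
qed

text \<open>
  The next contraction factor is independent of the accumulated noise, which has mean zero. Hence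
  the cross term in the second moment vanishes at each step. Mean zero and integrability are
  carried through the same induction, since the step needs them.
\<close>

lemma noise_sum_moments:
  assumes "1 \<le> n" "n \<le> k"
  shows "integrable M (\<lambda>\<omega>. noise_sum \<gamma> a n k (\<lambda>h. E h \<omega>)) \<and>
    integrable M (\<lambda>\<omega>. (noise_sum \<gamma> a n k (\<lambda>h. E h \<omega>))\<^sup>2) \<and>
    expectation (\<lambda>\<omega>. noise_sum \<gamma> a n k (\<lambda>h. E h \<omega>)) = 0 \<and>
    expectation (\<lambda>\<omega>. (noise_sum \<gamma> a n k (\<lambda>h. E h \<omega>))\<^sup>2) \<le> noise_bound a n k"
  using assms(2)
proof (induction k rule: dec_induct)
  case base
  then show ?case by (simp add: noise_sum_eq_0 noise_bound_def)
next
  case (step k)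
  define e where "e = exp_factor E \<gamma> k (Suc k)"
  define R where "R = (\<lambda>\<omega>. noise_sum \<gamma> a n k (\<lambda>h. E h \<omega>))"
  define m where "m = 1 / (1 + \<gamma> / real k)"
  define m2 where "m2 = 1 / (1 + 2 * \<gamma> / real k)"
  have k: "k \<ge> 1" using assms step.hyps by simp
  note [simp] = one_step_moments[OF k, folded e_def m_def m2_def]
  have [simp]: "integrable M R" "integrable M (\<lambda>\<omega>. (R \<omega>)\<^sup>2)" "expectation R = 0"
    and R2: "expectation (\<lambda>\<omega>. (R \<omega>)\<^sup>2) \<le> noise_bound a n k"
    using step.IH by (simp_all add: R_def)
  have ind: "indep_var borel R borel e"
    using indep_noise_sum_next_factor[OF assms(1) step.hyps(1), of a] by (simp add: R_def e_def)
  have ind2: "indep_var borel R borel (\<lambda>\<omega>. (e \<omega>)\<^sup>2)"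
    using indep_var_compose[OF ind, of "\<lambda>x. x" borel "\<lambda>x. x\<^sup>2" borel] by (simp add: comp_def)
  have ind22: "indep_var borel (\<lambda>\<omega>. (R \<omega>)\<^sup>2) borel (\<lambda>\<omega>. (e \<omega>)\<^sup>2)"
    using indep_var_compose[OF ind, of "\<lambda>x. x\<^sup>2" borel "\<lambda>x. x\<^sup>2" borel] by (simp add: comp_def)
  note [simp] = indep_var_integrable[OF ind] indep_var_integrable[OF ind2] indep_var_integrable[OF ind22]
    indep_var_lebesgue_integral[OF ind] indep_var_lebesgue_integral[OF ind2]
    indep_var_lebesgue_integral[OF ind22]
  have eq: "(\<lambda>\<omega>. noise_sum \<gamma> a n (Suc k) (\<lambda>h. E h \<omega>)) = (\<lambda>\<omega>. R \<omega> * e \<omega> + (a k * e \<omega> - a k * m))"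
    using step.hyps by (auto simp: fun_eq_iff R_def e_def m_def exp_factor_def algebra_simps)
  have eq2: "(\<lambda>\<omega>. (noise_sum \<gamma> a n (Suc k) (\<lambda>h. E h \<omega>))\<^sup>2)
      = (\<lambda>\<omega>. (R \<omega>)\<^sup>2 * (e \<omega>)\<^sup>2 + (2 * a k * (R \<omega> * (e \<omega>)\<^sup>2) - 2 * a k * m * (R \<omega> * e \<omega>))
          + ((a k)\<^sup>2 * (e \<omega>)\<^sup>2 - 2 * (a k)\<^sup>2 * m * e \<omega> + (a k)\<^sup>2 * m\<^sup>2))"
    by (subst fun_cong[OF eq]) (simp add: fun_eq_iff power2_eq_square algebra_simps)
  have "expectation (\<lambda>\<omega>. (noise_sum \<gamma> a n (Suc k) (\<lambda>h. E h \<omega>))\<^sup>2)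
      = expectation (\<lambda>\<omega>. (R \<omega>)\<^sup>2) * m2 + ((a k)\<^sup>2 * m2 - 2 * (a k)\<^sup>2 * m * m + (a k)\<^sup>2 * m\<^sup>2)"
    unfolding eq2 by (simp add: prob_space)
  also have "\<dots> = expectation (\<lambda>\<omega>. (R \<omega>)\<^sup>2) * m2 + (a k)\<^sup>2 * (m2 - m\<^sup>2)"
    by (simp add: algebra_simps power2_eq_square)
  also have "\<dots> \<le> noise_bound a n k * m2 + (a k)\<^sup>2 * (\<gamma>\<^sup>2 / (real k)\<^sup>2)"
    using R2 \<gamma>_pos one_step_variance_le[OF k]
    by (intro add_mono mult_right_mono mult_left_mono) (auto simp: m2_def m_def)
  also have "\<dots> = noise_bound a n (Suc k)"
    using noise_bound_Suc[OF step.hyps(1)] by (simp add: m2_def)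
  finally have le: "expectation (\<lambda>\<omega>. (noise_sum \<gamma> a n (Suc k) (\<lambda>h. E h \<omega>))\<^sup>2) \<le> noise_bound a n (Suc k)" .
  have "integrable M (\<lambda>\<omega>. (noise_sum \<gamma> a n (Suc k) (\<lambda>h. E h \<omega>))\<^sup>2)"
    unfolding eq2 by simp
  moreover have "integrable M (\<lambda>\<omega>. noise_sum \<gamma> a n (Suc k) (\<lambda>h. E h \<omega>))"
    unfolding eq by simp
  moreover have "expectation (\<lambda>\<omega>. noise_sum \<gamma> a n (Suc k) (\<lambda>h. E h \<omega>)) = 0"
    unfolding eq by (simp add: prob_space)
  ultimately show ?case using le by blast
qed

section \<open>Centred sums as accumulated noise\<close>

definition drift :: "(nat \<Rightarrow> real) \<Rightarrow> nat \<Rightarrow> real" where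
  "drift d k = (\<Sum>j = 1..k. d j * expectation (exp_factor E \<gamma> j k))"

definition centred_sum :: "(nat \<Rightarrow> real) \<Rightarrow> nat \<Rightarrow> 'a \<Rightarrow> real" where
  "centred_sum d k \<omega> = (\<Sum>j = 1..<k. d j * (exp_factor E \<gamma> j k \<omega> - expectation (exp_factor E \<gamma> j k)))"

lemma centred_sum_Suc:
  assumes "1 \<le> k"
  shows "centred_sum d (Suc k) \<omega> = exp_factor E \<gamma> k (Suc k) \<omega> * centred_sum d k \<omega>
     + drift d k * (exp_factor E \<gamma> k (Suc k) \<omega> - 1 / (1 + \<gamma> / real k))"
proof -
  define e where "e = exp_factor E \<gamma> k (Suc k) \<omega>"
  define m where "m = 1 / (1 + \<gamma> / real k)"
  let ?W = "\<lambda>j. exp_factor E \<gamma> j k \<omega>" and ?w = "\<lambda>j. expectation (exp_factor E \<gamma> j k)"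
  have w: "expectation (exp_factor E \<gamma> j (Suc k)) = ?w j * m" if "1 \<le> j" "j \<le> k" for j
    using that by (simp add: expectation_exp_factor m_def)
  have W: "exp_factor E \<gamma> j (Suc k) \<omega> = ?W j * e" if "j \<le> k" for j
    using exp_factor_Suc[OF that] by (simp add: e_def)
  have 1: "{1..<Suc k} = {1..k}" by auto
  have "centred_sum d (Suc k) \<omega> = (\<Sum>j = 1..k. d j * (?W j * e - ?w j * m))"
    unfolding centred_sum_def 1 by (intro sum.cong refl) (simp add: w W del: One_nat_def)
  also have "\<dots> = e * (\<Sum>j = 1..k. d j * (?W j - ?w j)) + drift d k * (e - m)"
    by (simp add: drift_def sum_distrib_left sum_distrib_right flip: sum.distrib)
       (intro sum.cong refl, simp add: algebra_simps)
  also have "(\<Sum>j = 1..k. d j * (?W j - ?w j)) = centred_sum d k \<omega>"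
  proof -
    have "{1..k} = insert k {1..<k}" using assms by auto
    moreover have "?W k - ?w k = 0" by (simp add: expectation_exp_factor[OF assms])
    ultimately show ?thesis by (simp add: centred_sum_def)
  qed
  finally show ?thesis by (simp add: e_def m_def)
qed

text \<open>
  From time \<open>n\<close> on, the past enters only through \<open>centred_sum d n\<close>, damped by a random factor
  that is almost surely in \<open>[0, 1]\<close>. This is what allows a bound uniform in \<open>k\<close> over a block starting at \<open>n\<close>.
\<close>

lemma centred_sum_restart:
  assumes "1 \<le> n" "n \<le> k"
  shows "centred_sum d k \<omega>
    = exp_factor E \<gamma> n k \<omega> * centred_sum d n \<omega> + noise_sum \<gamma> (drift d) n k (\<lambda>h. E h \<omega>)"
  using assms(2)
proof (induction k rule: dec_induct)
  case base
  then show ?case by (simp add: noise_sum_eq_0)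
next
  case (step k)
  have "exp_factor (\<lambda>h x. x h) \<gamma> k (Suc k) (\<lambda>h. E h \<omega>) = exp_factor E \<gamma> k (Suc k) \<omega>"
    by (simp add: exp_factor_def)
  then show ?case
    using step assms(1) exp_factor_Suc[OF step.hyps(1), of E \<gamma> \<omega>]
    by (simp add: centred_sum_Suc algebra_simps)
qed

lemma centred_sum_eq_noise_sum:
  "1 \<le> k \<Longrightarrow> centred_sum d k \<omega> = noise_sum \<gamma> (drift d) 1 k (\<lambda>h. E h \<omega>)"
  using centred_sum_restart[of 1 k d \<omega>] by (simp add: centred_sum_def)

end

section \<open>Power sums of the weights\<close>

definition power_sum :: "(nat \<Rightarrow> real) \<Rightarrow> real \<Rightarrow> nat \<Rightarrow> nat \<Rightarrow> real" where
  "power_sum d \<gamma> m k = (\<Sum>j = m..<k. d j * real j powr \<gamma>)"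

lemma power_sum_nonneg: "1 \<le> m \<Longrightarrow> (\<And>j. j \<ge> 1 \<Longrightarrow> d j > 0) \<Longrightarrow> 0 \<le> power_sum d \<gamma> m k"
  unfolding power_sum_def by (intro sum_nonneg mult_nonneg_nonneg) (auto intro: less_imp_le)

lemma power_sum_mono:
  "1 \<le> m \<Longrightarrow> (\<And>j. j \<ge> 1 \<Longrightarrow> d j > 0) \<Longrightarrow> h \<le> k \<Longrightarrow> power_sum d \<gamma> m h \<le> power_sum d \<gamma> m k"
  unfolding power_sum_def by (rule sum_mono2) (auto intro!: mult_nonneg_nonneg less_imp_le)

text \<open>
  The growth hypotheses see only the indices \<open>j \<ge> L\<close>. The finitely many earlier terms are absorbed
  into a constant: since \<open>d L > 0\<close>, the power sum from \<open>L\<close> on is bounded below by its first term.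
\<close>

lemma power_sum_start_irrelevant:
  assumes d: "\<And>j. j \<ge> 1 \<Longrightarrow> d j > 0" and L: "1 \<le> L"
  obtains K where "K \<ge> 0"
    and "\<And>h. L \<le> h \<Longrightarrow> power_sum d \<gamma> 1 (Suc h) \<le> K * power_sum d \<gamma> L (Suc h)"
    and "\<And>k. L < k \<Longrightarrow> (\<Sum>h = 1..<k. (power_sum d \<gamma> 1 (Suc h))\<^sup>2 / (real h)\<^sup>2)
       \<le> K * (\<Sum>h = L..<k. (power_sum d \<gamma> L (Suc h))\<^sup>2 / (real h)\<^sup>2)"
proof -
  define b where "b h = power_sum d \<gamma> 1 (Suc h)" for h
  define c where "c h = power_sum d \<gamma> L (Suc h)" for h
  define K where "K = 1 + power_sum d \<gamma> 1 L / c L"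
  have cL: "c L > 0" using d L by (simp add: c_def power_sum_def)
  have c_mono: "c L \<le> c h" if "L \<le> h" for h
    unfolding c_def by (rule power_sum_mono) (use that L d in auto)
  have B: "0 \<le> power_sum d \<gamma> 1 L" by (rule power_sum_nonneg) (use d in auto)
  have K: "K \<ge> 1" using B cL by (simp add: K_def)
  have bc: "b h \<le> K * c h" if "L \<le> h" for h
  proof -
    have "b h = power_sum d \<gamma> 1 L + c h"
      using that L unfolding b_def c_def power_sum_def by (subst sum.atLeastLessThan_concat) auto
    also have "power_sum d \<gamma> 1 L = power_sum d \<gamma> 1 L / c L * c L"
      using cL by simp
    also have "\<dots> \<le> power_sum d \<gamma> 1 L / c L * c h"
      using B cL c_mono[OF that] by (intro mult_left_mono) auto
    finally show ?thesis by (simp add: K_def algebra_simps)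
  qed
  define H where "H = (\<Sum>h = 1..<L. (b h)\<^sup>2 / (real h)\<^sup>2)"
  define t where "t = (c L)\<^sup>2 / (real L)\<^sup>2"
  have t: "t > 0" using cL L by (simp add: t_def)
  have H: "H \<ge> 0" unfolding H_def by (intro sum_nonneg) auto
  have "(\<Sum>h = 1..<k. (b h)\<^sup>2 / (real h)\<^sup>2) \<le> (H / t + K\<^sup>2) * (\<Sum>h = L..<k. (c h)\<^sup>2 / (real h)\<^sup>2)" if "L < k" for k
  proof -
    have "t \<le> (\<Sum>h = L..<k. (c h)\<^sup>2 / (real h)\<^sup>2)"
      unfolding t_def by (rule member_le_sum) (use that in auto)
    then have "H / t * t \<le> H / t * (\<Sum>h = L..<k. (c h)\<^sup>2 / (real h)\<^sup>2)"
      using H t by (intro mult_left_mono) auto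
    then have "H \<le> H / t * (\<Sum>h = L..<k. (c h)\<^sup>2 / (real h)\<^sup>2)" using t by simp
    moreover have "(\<Sum>h = L..<k. (b h)\<^sup>2 / (real h)\<^sup>2) \<le> (\<Sum>h = L..<k. (K * c h)\<^sup>2 / (real h)\<^sup>2)"
      using L d bc by (intro sum_mono divide_right_mono power_mono)
        (auto simp: b_def intro!: power_sum_nonneg)
    moreover have "(\<Sum>h = L..<k. (K * c h)\<^sup>2 / (real h)\<^sup>2) = K\<^sup>2 * (\<Sum>h = L..<k. (c h)\<^sup>2 / (real h)\<^sup>2)"
      by (simp add: sum_distrib_left power_mult_distrib)
    moreover have "(\<Sum>h = 1..<k. (b h)\<^sup>2 / (real h)\<^sup>2) = H + (\<Sum>h = L..<k. (b h)\<^sup>2 / (real h)\<^sup>2)"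
      unfolding H_def using that L by (subst sum.atLeastLessThan_concat) auto
    ultimately show ?thesis by (simp add: distrib_right)
  qed
  note sq = this
  show thesis
  proof (rule that[of "K + (H / t + K\<^sup>2)"])
    show "0 \<le> K + (H / t + K\<^sup>2)" using K H t by simp
    show "power_sum d \<gamma> 1 (Suc h) \<le> (K + (H / t + K\<^sup>2)) * power_sum d \<gamma> L (Suc h)" if "L \<le> h" for h
    proof -
      have "b h \<le> K * c h" by (rule bc[OF that])
      also have "\<dots> \<le> (K + (H / t + K\<^sup>2)) * c h"
        using H t K cL c_mono[OF that] by (intro mult_right_mono) auto
      finally show ?thesis by (simp add: b_def c_def)
    qed
    show "(\<Sum>h = 1..<k. (power_sum d \<gamma> 1 (Suc h))\<^sup>2 / (real h)\<^sup>2)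
       \<le> (K + (H / t + K\<^sup>2)) * (\<Sum>h = L..<k. (power_sum d \<gamma> L (Suc h))\<^sup>2 / (real h)\<^sup>2)" if "L < k" for k
    proof -
      have "0 \<le> K * (\<Sum>h = L..<k. (c h)\<^sup>2 / (real h)\<^sup>2)"
        using K by (intro mult_nonneg_nonneg sum_nonneg) auto
      then show ?thesis using sq[OF that] by (simp add: b_def c_def distrib_right)
    qed
  qed
qed

text \<open>
  With \<open>c\<close> for the power sums from \<open>L\<close> on, expand \<open>(c (j + 1))\<^sup>2 - (c j)\<^sup>2\<close> by
  \<open>c (j + 1) = c j + d j * j powr \<gamma>\<close>. In the diagonal part the factor \<open>1 / j\<close> is dropped; in
  the cross term the powers \<open>(i * j) powr \<gamma>\<close> are replaced by \<open>k powr (2 * \<gamma>)\<close>.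
\<close>

lemma weighted_increments_power_sum_le:
  assumes d: "\<And>j. j \<ge> 1 \<Longrightarrow> d j > 0" and L: "1 \<le> L" and \<gamma>: "\<gamma> > 0"
  shows "(\<Sum>j = L..<k. ((power_sum d \<gamma> L (Suc j))\<^sup>2 - (power_sum d \<gamma> L j)\<^sup>2) / real j)
    \<le> (\<Sum>j = L..<k. (d j)\<^sup>2 * real j powr (2 * \<gamma>))
      + 2 * (real k powr (2 * \<gamma>) * (\<Sum>j = L + 1..<k. (\<Sum>i = L..<j. d i) * d j * (1 / real j)))"
proof -
  let ?s = "\<lambda>j. (\<Sum>i = L..<j. d i) * d j * (1 / real j)"
  have s_sum: "(\<Sum>j = L + 1..<k. ?s j) = (\<Sum>j = L..<k. ?s j)"
    by (cases "L < k") (simp_all add: sum.atLeast_Suc_lessThan)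
  have "((power_sum d \<gamma> L (Suc j))\<^sup>2 - (power_sum d \<gamma> L j)\<^sup>2) / real j
      \<le> (d j)\<^sup>2 * real j powr (2 * \<gamma>) + 2 * (real k powr (2 * \<gamma>) * ?s j)"
    if j: "L \<le> j" "j < k" for j
  proof -
    define p where "p = real j powr \<gamma>"
    have jj: "real j \<ge> 1" using j L by simp
    have p: "p > 0" "p\<^sup>2 = real j powr (2 * \<gamma>)"
      using jj by (auto simp: p_def power2_eq_square simp flip: powr_add)
    have dj: "d j > 0" using d j L by simp
    have c: "power_sum d \<gamma> L j \<le> (\<Sum>i = L..<j. d i) * p"
      unfolding power_sum_def sum_distrib_right p_def
      by (intro sum_mono mult_left_mono powr_mono2) (use \<gamma> d L in \<open>auto intro: less_imp_le\<close>)
    have "power_sum d \<gamma> L (Suc j) = power_sum d \<gamma> L j + d j * p"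
      using j by (simp add: power_sum_def p_def)
    then have "(power_sum d \<gamma> L (Suc j))\<^sup>2 - (power_sum d \<gamma> L j)\<^sup>2
        = (d j)\<^sup>2 * p\<^sup>2 + 2 * (d j * p * power_sum d \<gamma> L j)"
      by (simp add: power2_eq_square algebra_simps)
    also have "\<dots> \<le> (d j)\<^sup>2 * p\<^sup>2 + 2 * (d j * p * ((\<Sum>i = L..<j. d i) * p))"
      using c dj p by (intro add_left_mono mult_left_mono) auto
    also have "\<dots> = (d j)\<^sup>2 * p\<^sup>2 + 2 * (p\<^sup>2 * ((\<Sum>i = L..<j. d i) * d j))"
      by (simp add: power2_eq_square algebra_simps)
    finally have "((power_sum d \<gamma> L (Suc j))\<^sup>2 - (power_sum d \<gamma> L j)\<^sup>2) / real j
        \<le> ((d j)\<^sup>2 * p\<^sup>2 + 2 * (p\<^sup>2 * ((\<Sum>i = L..<j. d i) * d j))) / real j"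
      by (rule divide_right_mono) simp
    also have "\<dots> = (d j)\<^sup>2 * p\<^sup>2 / real j + 2 * (p\<^sup>2 * ?s j)"
      by (simp add: add_divide_distrib)
    also have "(d j)\<^sup>2 * p\<^sup>2 / real j \<le> (d j)\<^sup>2 * p\<^sup>2"
      using jj mult_left_mono[of 1 "real j" "(d j)\<^sup>2 * p\<^sup>2"] by (simp add: divide_le_eq)
    also have "p\<^sup>2 * ?s j \<le> real k powr (2 * \<gamma>) * ?s j"
    proof (rule mult_right_mono)
      show "p\<^sup>2 \<le> real k powr (2 * \<gamma>)"
        unfolding p using \<gamma> j by (intro powr_mono2) auto
      have "0 \<le> (\<Sum>i = L..<j. d i)" using d L by (intro sum_nonneg) (auto intro: less_imp_le)
      then show "0 \<le> ?s j" using dj by simp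
    qed
    finally show ?thesis unfolding p by simp
  qed
  then have "(\<Sum>j = L..<k. ((power_sum d \<gamma> L (Suc j))\<^sup>2 - (power_sum d \<gamma> L j)\<^sup>2) / real j)
      \<le> (\<Sum>j = L..<k. (d j)\<^sup>2 * real j powr (2 * \<gamma>) + 2 * (real k powr (2 * \<gamma>) * ?s j))"
    by (intro sum_mono) auto
  then show ?thesis
    unfolding s_sum by (simp add: sum.distrib sum_distrib_left)
qed

section \<open>Growth of the drift and of the noise\<close>

context exponential_sequence
begin

lemma drift_pos:
  assumes "\<And>j. j \<ge> 1 \<Longrightarrow> d j > 0" "1 \<le> h"
  shows "drift d h > 0"
  unfolding drift_def
proof (rule sum_pos)
  fix j assume "j \<in> {1..h}"
  then have "expectation (exp_factor E \<gamma> j h) > 0"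
    using \<gamma>_pos by (subst expectation_exp_factor) (auto intro!: prod_pos simp: add_pos_nonneg)
  then show "0 < d j * expectation (exp_factor E \<gamma> j h)" using assms \<open>j \<in> {1..h}\<close> by simp
qed (use assms in auto)

lemma drift_le:
  assumes d: "\<And>j. j \<ge> 1 \<Longrightarrow> d j > 0" and h: "1 \<le> h"
  shows "drift d h \<le> exp (2 * \<gamma>\<^sup>2) * power_sum d \<gamma> 1 (Suc h) / real h powr \<gamma>"
proof -
  have "drift d h \<le> (\<Sum>j = 1..h. d j * (exp (2 * \<gamma>\<^sup>2) * (real j / real h) powr \<gamma>))"
    unfolding drift_def
  proof (intro sum_mono mult_left_mono)
    fix j assume j: "j \<in> {1..h}"
    then have "1 \<le> j" by simp
    then show "expectation (exp_factor E \<gamma> j h) \<le> exp (2 * \<gamma>\<^sup>2) * (real j / real h) powr \<gamma>"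
      unfolding expectation_exp_factor[OF \<open>1 \<le> j\<close>]
      by (intro prod_inverse_le_powr_ratio) (use j \<gamma>_pos in auto)
    show "0 \<le> d j" using d \<open>1 \<le> j\<close> by (simp add: less_imp_le)
  qed
  also have "\<dots> = (\<Sum>j = 1..h. exp (2 * \<gamma>\<^sup>2) * (d j * real j powr \<gamma>) / real h powr \<gamma>)"
    by (intro sum.cong refl) (simp add: powr_divide)
  also have "\<dots> = exp (2 * \<gamma>\<^sup>2) * power_sum d \<gamma> 1 (Suc h) / real h powr \<gamma>"
    by (simp add: power_sum_def sum_distrib_left sum_divide_distrib atLeastLessThanSuc_atLeastAtMost)
  finally show ?thesis .
qed

lemma drift_square_le:
  assumes d: "\<And>j. j \<ge> 1 \<Longrightarrow> d j > 0" and h: "1 \<le> h"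
  shows "(drift d h)\<^sup>2 \<le> exp (4 * \<gamma>\<^sup>2) * (power_sum d \<gamma> 1 (Suc h))\<^sup>2 / real h powr (2 * \<gamma>)"
proof -
  have "(drift d h)\<^sup>2 \<le> (exp (2 * \<gamma>\<^sup>2) * power_sum d \<gamma> 1 (Suc h) / real h powr \<gamma>)\<^sup>2"
    using drift_le[OF d h] less_imp_le[OF drift_pos[of d h, OF d h]] by (intro power_mono) auto
  also have "\<dots> = exp (4 * \<gamma>\<^sup>2) * (power_sum d \<gamma> 1 (Suc h))\<^sup>2 / real h powr (2 * \<gamma>)"
    by (simp add: power_mult_distrib power_divide power2_eq_square flip: exp_add powr_add)
  finally show ?thesis .
qed

lemma noise_bound_pos:
  assumes "\<And>j. j \<ge> 1 \<Longrightarrow> d j > 0" "1 \<le> n" "n < k"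
  shows "noise_bound (drift d) n k > 0"
  unfolding noise_bound_def
proof (rule sum_pos)
  fix h assume "h \<in> {n..<k}"
  then have "drift d h > 0" "real h > 0" using drift_pos assms by auto
  then show "0 < \<gamma>\<^sup>2 * (drift d h)\<^sup>2 / (real h)\<^sup>2 * (\<Prod>l = Suc h..<k. 1 / (1 + 2 * \<gamma> / real l))"
    using \<gamma>_pos by (intro mult_pos_pos prod_pos divide_pos_pos) (auto simp: add_pos_nonneg)
qed (use assms in auto)

lemma noise_bound_le_sum:
  "noise_bound a n k \<le> (\<Sum>h = n..<k. \<gamma>\<^sup>2 * (a h)\<^sup>2 / (real h)\<^sup>2)"
  unfolding noise_bound_def
proof (rule sum_mono)
  fix h
  have "(\<Prod>l = Suc h..<k. 1 / (1 + 2 * \<gamma> / real l)) \<le> 1"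
    using \<gamma>_pos by (intro prod_le_1) (auto simp: add_pos_nonneg field_simps)
  then show "\<gamma>\<^sup>2 * (a h)\<^sup>2 / (real h)\<^sup>2 * (\<Prod>l = Suc h..<k. 1 / (1 + 2 * \<gamma> / real l))
      \<le> \<gamma>\<^sup>2 * (a h)\<^sup>2 / (real h)\<^sup>2"
    by (intro mult_left_le) auto
qed

text \<open>
  The damping after step \<open>h\<close> is of order \<open>(h / n) powr (2 * \<gamma>)\<close>, and its numerator cancels the
  denominator \<open>h powr (2 * \<gamma>)\<close> of the squared drift. The damping starts at \<open>h + 1\<close>, and replacing
  \<open>h + 1\<close> by \<open>2 * h\<close> costs the factor \<open>2 powr (2 * \<gamma>)\<close>.
\<close>

lemma noise_bound_drift_le:
  assumes d: "\<And>j. j \<ge> 1 \<Longrightarrow> d j > 0"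
  shows "noise_bound (drift d) 1 n \<le> \<gamma>\<^sup>2 * exp (12 * \<gamma>\<^sup>2) * 2 powr (2 * \<gamma>) / real n powr (2 * \<gamma>)
    * (\<Sum>h = 1..<n. (power_sum d \<gamma> 1 (Suc h))\<^sup>2 / (real h)\<^sup>2)"
  unfolding noise_bound_def sum_distrib_left
proof (rule sum_mono)
  fix h assume h: "h \<in> {1..<n}"
  let ?b = "power_sum d \<gamma> 1 (Suc h)"
  have "(\<Prod>l = Suc h..<n. 1 / (1 + 2 * \<gamma> / real l))
      \<le> exp (2 * (2 * \<gamma>)\<^sup>2) * (real (Suc h) / real n) powr (2 * \<gamma>)"
    by (rule prod_inverse_le_powr_ratio) (use h \<gamma>_pos in auto)
  also have "\<dots> \<le> exp (8 * \<gamma>\<^sup>2) * ((2 * real h) / real n) powr (2 * \<gamma>)"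
    using h \<gamma>_pos by (intro mult_mono powr_mono2 divide_right_mono) (auto simp: power2_eq_square)
  also have "\<dots> = exp (8 * \<gamma>\<^sup>2) * 2 powr (2 * \<gamma>) * real h powr (2 * \<gamma>) / real n powr (2 * \<gamma>)"
    by (simp add: powr_divide powr_mult)
  finally have "\<gamma>\<^sup>2 * (drift d h)\<^sup>2 / (real h)\<^sup>2 * (\<Prod>l = Suc h..<n. 1 / (1 + 2 * \<gamma> / real l))
      \<le> \<gamma>\<^sup>2 * (exp (4 * \<gamma>\<^sup>2) * ?b\<^sup>2 / real h powr (2 * \<gamma>)) / (real h)\<^sup>2
        * (exp (8 * \<gamma>\<^sup>2) * 2 powr (2 * \<gamma>) * real h powr (2 * \<gamma>) / real n powr (2 * \<gamma>))"
    using h \<gamma>_pos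
    by (intro mult_mono divide_right_mono mult_left_mono drift_square_le d prod_nonneg)
       (auto simp: add_nonneg_nonneg)
  also have "\<dots> = \<gamma>\<^sup>2 * (exp (4 * \<gamma>\<^sup>2) * exp (8 * \<gamma>\<^sup>2)) * 2 powr (2 * \<gamma>) / real n powr (2 * \<gamma>)
      * (?b\<^sup>2 / (real h)\<^sup>2)"
    using h by (simp add: mult_ac)
  also have "exp (4 * \<gamma>\<^sup>2) * exp (8 * \<gamma>\<^sup>2) = exp (12 * \<gamma>\<^sup>2)"
    by (simp flip: exp_add)
  finally show "\<gamma>\<^sup>2 * (drift d h)\<^sup>2 / (real h)\<^sup>2 * (\<Prod>l = Suc h..<n. 1 / (1 + 2 * \<gamma> / real l))
      \<le> \<gamma>\<^sup>2 * exp (12 * \<gamma>\<^sup>2) * 2 powr (2 * \<gamma>) / real n powr (2 * \<gamma>) * (?b\<^sup>2 / (real h)\<^sup>2)" .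
qed

text \<open>
  The factor \<open>\<alpha> k\<close> belongs to the late time \<open>k\<close>, while the noise is accumulated up to, or from, an
  earlier time \<open>n\<close>. The hypotheses are therefore applied at \<open>k\<close>, and \<open>k \<le> 4 * n\<close> makes the powers of
  \<open>n\<close> and \<open>k\<close> comparable; this covers \<open>n = q\<^sup>2\<close> and \<open>k \<le> (q + 1)\<^sup>2\<close>. For the noise between \<open>n\<close> and
  \<open>k\<close>, each of the \<open>k - n\<close> steps contributes, after scaling by \<open>(\<alpha> k)\<^sup>2\<close>, at most a constant times
  \<open>k powr \<nu>\<close>, since the boundary term of the summation by parts bounds \<open>(\<alpha> k * a h)\<^sup>2\<close> by a multiple of \<open>k powr (2 + \<nu>)\<close>.
\<close>

lemma scaled_noise_bounds:
  fixes \<alpha> d :: "nat \<Rightarrow> real" and \<nu> C1 C2 :: real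
  assumes d: "\<And>j. j \<ge> 1 \<Longrightarrow> d j > 0" and L: "1 \<le> L"
    and C1: "\<And>k. k \<ge> L \<Longrightarrow> (\<alpha> k)\<^sup>2 / real k powr (2 * \<gamma> + 1 + \<nu>) *
           (\<Sum>j = L..<k. (d j)\<^sup>2 * real j powr (2 * \<gamma>)) \<le> C1"
    and C2: "\<And>k. k \<ge> L \<Longrightarrow> (\<alpha> k)\<^sup>2 / real k powr (1 + \<nu>) *
           (\<Sum>j = L + 1..<k. (\<Sum>i = L..<j. d i) * d j * (1 / real j)) \<le> C2"
  obtains C where "C > 0"
    and "\<And>n k. L \<le> n \<Longrightarrow> n < k \<Longrightarrow> k \<le> 4 * n \<Longrightarrow>
      (\<alpha> k)\<^sup>2 * noise_bound (drift d) 1 n \<le> C * real k powr (1 + \<nu>)"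
    and "\<And>n k. L \<le> n \<Longrightarrow> n < k \<Longrightarrow> k \<le> 4 * n \<Longrightarrow>
      (\<alpha> k)\<^sup>2 * noise_bound (drift d) n k \<le> C * real (k - n) * real k powr \<nu>"
proof -
  define c where "c = power_sum d \<gamma> L"
  define T where "T k = (\<Sum>j = L..<k. ((c (Suc j))\<^sup>2 - (c j)\<^sup>2) / real j)" for k
  \<comment> \<open>The bounds \<open>C1\<close> and \<open>C2\<close> have no prescribed sign; \<open>C0\<close> majorizes their combination and is positive.\<close>
  define C0 where "C0 = \<bar>C1 + 2 * C2\<bar> + 1"
  obtain K where K: "K \<ge> 0"
    and bc: "\<And>h. L \<le> h \<Longrightarrow> power_sum d \<gamma> 1 (Suc h) \<le> K * c (Suc h)"
    and sq: "\<And>k. L < k \<Longrightarrow> (\<Sum>h = 1..<k. (power_sum d \<gamma> 1 (Suc h))\<^sup>2 / (real h)\<^sup>2)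
       \<le> K * (\<Sum>h = L..<k. (c (Suc h))\<^sup>2 / (real h)\<^sup>2)"
    using power_sum_start_irrelevant[of d L \<gamma>] d L unfolding c_def by blast
  have c_nonneg: "0 \<le> c h" for h
    unfolding c_def by (rule power_sum_nonneg) (use L d in auto)
  have telescope: "(\<Sum>h = L..<k. (c (Suc h))\<^sup>2 / (real h)\<^sup>2) + 2 * (c k)\<^sup>2 / real k \<le> 2 * T k"
    if "L \<le> k" for k
    unfolding T_def using L that by (intro sum_squares_le_weighted_increments) (auto simp: c_def power_sum_def)
  have \<alpha>T: "(\<alpha> k)\<^sup>2 * T k \<le> C0 * real k powr (2 * \<gamma> + 1 + \<nu>)" if "L \<le> k" for k
  proof -
    let ?S1 = "\<Sum>j = L..<k. (d j)\<^sup>2 * real j powr (2 * \<gamma>)"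
    let ?S2 = "\<Sum>j = L + 1..<k. (\<Sum>i = L..<j. d i) * d j * (1 / real j)"
    have k: "real k > 0" using that L by simp
    have "(\<alpha> k)\<^sup>2 * ?S1 \<le> C1 * real k powr (2 * \<gamma> + 1 + \<nu>)"
      using C1[OF that] k by (simp add: field_simps)
    moreover have "(\<alpha> k)\<^sup>2 * ?S2 \<le> C2 * real k powr (1 + \<nu>)"
      using C2[OF that] k by (simp add: field_simps)
    then have "real k powr (2 * \<gamma>) * ((\<alpha> k)\<^sup>2 * ?S2) \<le> real k powr (2 * \<gamma>) * (C2 * real k powr (1 + \<nu>))"
      by (rule mult_left_mono) simp
    then have "real k powr (2 * \<gamma>) * ((\<alpha> k)\<^sup>2 * ?S2) \<le> C2 * real k powr (2 * \<gamma> + 1 + \<nu>)"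
      by (simp add: powr_add mult_ac)
    moreover have "(\<alpha> k)\<^sup>2 * T k \<le> (\<alpha> k)\<^sup>2 * (?S1 + 2 * (real k powr (2 * \<gamma>) * ?S2))"
      unfolding T_def c_def using d L \<gamma>_pos
      by (intro mult_left_mono weighted_increments_power_sum_le) auto
    ultimately have "(\<alpha> k)\<^sup>2 * T k \<le> (C1 + 2 * C2) * real k powr (2 * \<gamma> + 1 + \<nu>)"
      by (simp add: algebra_simps)
    also have "\<dots> \<le> C0 * real k powr (2 * \<gamma> + 1 + \<nu>)"
      unfolding C0_def by (intro mult_right_mono) auto
    finally show ?thesis .
  qed
  have C0: "C0 > 0" by (simp add: C0_def)
  have powr_comparable: "1 / real n powr (2 * \<gamma>) \<le> 4 powr (2 * \<gamma>) / real k powr (2 * \<gamma>)"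
    if "1 \<le> n" "n < k" "k \<le> 4 * n" for n k :: nat
  proof -
    have "real k powr (2 * \<gamma>) \<le> (4 * real n) powr (2 * \<gamma>)"
      using that \<gamma>_pos by (intro powr_mono2) auto
    then show ?thesis using that by (simp add: powr_mult field_simps)
  qed
  define P where "P = \<gamma>\<^sup>2 * exp (12 * \<gamma>\<^sup>2) * 2 powr (2 * \<gamma>) * 4 powr (2 * \<gamma>) * K * 2 * C0"
  define Q where "Q = 16 * \<gamma>\<^sup>2 * exp (4 * \<gamma>\<^sup>2) * K\<^sup>2 * 4 powr (2 * \<gamma>) * C0"
  have P: "P \<ge> 0" and Q: "Q \<ge> 0" using K C0 by (simp_all add: P_def Q_def)
  have old: "(\<alpha> k)\<^sup>2 * noise_bound (drift d) 1 n \<le> P * real k powr (1 + \<nu>)"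
    if n: "L \<le> n" "n < k" "k \<le> 4 * n" for n k
  proof -
    let ?D = "\<gamma>\<^sup>2 * exp (12 * \<gamma>\<^sup>2) * 2 powr (2 * \<gamma>)"
    have k: "real k > 0" using n by simp
    have "(\<Sum>h = 1..<n. (power_sum d \<gamma> 1 (Suc h))\<^sup>2 / (real h)\<^sup>2)
        \<le> (\<Sum>h = 1..<k. (power_sum d \<gamma> 1 (Suc h))\<^sup>2 / (real h)\<^sup>2)"
      by (rule sum_mono2) (use n in auto)
    also have "\<dots> \<le> K * (\<Sum>h = L..<k. (c (Suc h))\<^sup>2 / (real h)\<^sup>2)"
      by (rule sq) (use n in auto)
    also have "\<dots> \<le> K * (2 * T k)"
    proof (intro mult_left_mono K)
      have "0 \<le> 2 * (c k)\<^sup>2 / real k" by simp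
      then show "(\<Sum>h = L..<k. (c (Suc h))\<^sup>2 / (real h)\<^sup>2) \<le> 2 * T k"
        using telescope[of k] n by linarith
    qed
    finally have S: "(\<Sum>h = 1..<n. (power_sum d \<gamma> 1 (Suc h))\<^sup>2 / (real h)\<^sup>2) \<le> K * (2 * T k)" .
    have "noise_bound (drift d) 1 n \<le> ?D / real n powr (2 * \<gamma>)
        * (\<Sum>h = 1..<n. (power_sum d \<gamma> 1 (Suc h))\<^sup>2 / (real h)\<^sup>2)"
      by (rule noise_bound_drift_le[OF d])
    also have "\<dots> \<le> ?D * (4 powr (2 * \<gamma>) / real k powr (2 * \<gamma>)) * (K * (2 * T k))"
    proof (rule mult_mono)
      show "?D / real n powr (2 * \<gamma>) \<le> ?D * (4 powr (2 * \<gamma>) / real k powr (2 * \<gamma>))"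
        using mult_left_mono[OF powr_comparable[of n k], of ?D] n L by simp
    qed (use S in \<open>auto intro: sum_nonneg\<close>)
    finally have "(\<alpha> k)\<^sup>2 * noise_bound (drift d) 1 n
        \<le> (\<alpha> k)\<^sup>2 * (?D * (4 powr (2 * \<gamma>) / real k powr (2 * \<gamma>)) * (K * (2 * T k)))"
      by (rule mult_left_mono) simp
    also have "\<dots> = ?D * (4 powr (2 * \<gamma>) / real k powr (2 * \<gamma>)) * (K * 2) * ((\<alpha> k)\<^sup>2 * T k)"
      by (simp add: mult_ac)
    also have "\<dots> \<le> ?D * (4 powr (2 * \<gamma>) / real k powr (2 * \<gamma>)) * (K * 2)
        * (C0 * real k powr (2 * \<gamma> + 1 + \<nu>))"
      using n K by (intro mult_left_mono \<alpha>T) auto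
    also have "\<dots> = P * real k powr (1 + \<nu>)"
      using k by (simp add: P_def powr_add)
    finally show ?thesis .
  qed
  have new: "(\<alpha> k)\<^sup>2 * noise_bound (drift d) n k \<le> Q * real (k - n) * real k powr \<nu>"
    if n: "L \<le> n" "n < k" "k \<le> 4 * n" for n k
  proof -
    have k: "real k > 0" using n by simp
    have ck: "(c k)\<^sup>2 \<le> real k * T k"
    proof -
      have "0 \<le> (\<Sum>h = L..<k. (c (Suc h))\<^sup>2 / (real h)\<^sup>2)" by (intro sum_nonneg) auto
      then have "2 * (c k)\<^sup>2 / real k \<le> 2 * T k" using telescope[of k] n by linarith
      then show ?thesis using k by (simp add: field_simps)
    qed
    have "(\<alpha> k)\<^sup>2 * (\<gamma>\<^sup>2 * (drift d h)\<^sup>2 / (real h)\<^sup>2) \<le> Q * real k powr \<nu>" if h: "h \<in> {n..<k}" for h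
    proof -
      have hh: "1 \<le> h" "L \<le> h" "h < k" "k \<le> 4 * h" using h n L by auto
      have "power_sum d \<gamma> 1 (Suc h) \<le> K * c (Suc h)" by (rule bc) (use hh in auto)
      also have "\<dots> \<le> K * c k"
        unfolding c_def using hh L d by (intro mult_left_mono K power_sum_mono) auto
      finally have b: "(power_sum d \<gamma> 1 (Suc h))\<^sup>2 \<le> (K * c k)\<^sup>2"
        by (rule power_mono) (use d in \<open>auto intro!: power_sum_nonneg\<close>)
      have "(drift d h)\<^sup>2 \<le> exp (4 * \<gamma>\<^sup>2) * (power_sum d \<gamma> 1 (Suc h))\<^sup>2 * (1 / real h powr (2 * \<gamma>))"
        using drift_square_le[OF d hh(1)] by simp
      also have "\<dots> \<le> exp (4 * \<gamma>\<^sup>2) * (K\<^sup>2 * (real k * T k)) * (4 powr (2 * \<gamma>) / real k powr (2 * \<gamma>))"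
      proof (intro mult_mono powr_comparable hh)
        have "(K * c k)\<^sup>2 \<le> K\<^sup>2 * (real k * T k)"
          unfolding power_mult_distrib using ck by (intro mult_left_mono) auto
        then show "(power_sum d \<gamma> 1 (Suc h))\<^sup>2 \<le> K\<^sup>2 * (real k * T k)" using b by linarith
        then show "0 \<le> exp (4 * \<gamma>\<^sup>2) * (K\<^sup>2 * (real k * T k))"
          by (meson exp_ge_zero mult_nonneg_nonneg order_trans zero_le_power2)
      qed auto
      finally have a: "(drift d h)\<^sup>2
        \<le> exp (4 * \<gamma>\<^sup>2) * (K\<^sup>2 * (real k * T k)) * (4 powr (2 * \<gamma>) / real k powr (2 * \<gamma>))" .
      have "1 / (real h)\<^sup>2 \<le> 16 / (real k)\<^sup>2"
      proof -
        have "(real k)\<^sup>2 \<le> (4 * real h)\<^sup>2" using hh by (intro power_mono) auto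
        then show ?thesis using hh k by (simp add: field_simps)
      qed
      then have "\<gamma>\<^sup>2 * (drift d h)\<^sup>2 * (1 / (real h)\<^sup>2) \<le> \<gamma>\<^sup>2 *
          (exp (4 * \<gamma>\<^sup>2) * (K\<^sup>2 * (real k * T k)) * (4 powr (2 * \<gamma>) / real k powr (2 * \<gamma>))) * (16 / (real k)\<^sup>2)"
        using a order_trans[OF zero_le_power2 a]
        by (intro mult_mono mult_left_mono mult_nonneg_nonneg[OF zero_le_power2]) auto
      then have "(\<alpha> k)\<^sup>2 * (\<gamma>\<^sup>2 * (drift d h)\<^sup>2 * (1 / (real h)\<^sup>2)) \<le> (\<alpha> k)\<^sup>2 * (\<gamma>\<^sup>2 *
          (exp (4 * \<gamma>\<^sup>2) * (K\<^sup>2 * (real k * T k)) * (4 powr (2 * \<gamma>) / real k powr (2 * \<gamma>))) * (16 / (real k)\<^sup>2))"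
        by (rule mult_left_mono) simp
      also have "\<dots> = 16 * \<gamma>\<^sup>2 * exp (4 * \<gamma>\<^sup>2) * K\<^sup>2 * (4 powr (2 * \<gamma>) / real k powr (2 * \<gamma>))
          * (1 / real k) * ((\<alpha> k)\<^sup>2 * T k)"
        using k by (simp add: power2_eq_square)
      also have "\<dots> \<le> 16 * \<gamma>\<^sup>2 * exp (4 * \<gamma>\<^sup>2) * K\<^sup>2 * (4 powr (2 * \<gamma>) / real k powr (2 * \<gamma>))
          * (1 / real k) * (C0 * real k powr (2 * \<gamma> + 1 + \<nu>))"
        using n by (intro mult_left_mono \<alpha>T) auto
      also have "\<dots> = Q * real k powr \<nu>"
        using k by (simp add: Q_def powr_add)
      finally show ?thesis by simp
    qed
    then have "(\<Sum>h = n..<k. (\<alpha> k)\<^sup>2 * (\<gamma>\<^sup>2 * (drift d h)\<^sup>2 / (real h)\<^sup>2)) \<le> (\<Sum>h = n..<k. Q * real k powr \<nu>)"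
      by (rule sum_mono)
    moreover have "(\<alpha> k)\<^sup>2 * noise_bound (drift d) n k
        \<le> (\<alpha> k)\<^sup>2 * (\<Sum>h = n..<k. \<gamma>\<^sup>2 * (drift d h)\<^sup>2 / (real h)\<^sup>2)"
      by (rule mult_left_mono[OF noise_bound_le_sum]) simp
    ultimately show ?thesis by (simp add: sum_distrib_left mult_ac)
  qed
  show thesis
  proof (rule that[of "P + Q + 1"])
    show "P + Q + 1 > 0" using P Q by simp
    fix n k assume n: "L \<le> n" "n < k" "k \<le> 4 * n"
    have "P * real k powr (1 + \<nu>) \<le> (P + Q + 1) * real k powr (1 + \<nu>)"
      using Q by (intro mult_right_mono) auto
    then show "(\<alpha> k)\<^sup>2 * noise_bound (drift d) 1 n \<le> (P + Q + 1) * real k powr (1 + \<nu>)"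
      using old[OF n] by linarith
    have "Q * real (k - n) * real k powr \<nu> \<le> (P + Q + 1) * real (k - n) * real k powr \<nu>"
      using P by (intro mult_right_mono) auto
    then show "(\<alpha> k)\<^sup>2 * noise_bound (drift d) n k \<le> (P + Q + 1) * real (k - n) * real k powr \<nu>"
      using new[OF n] by linarith
  qed
qed

section \<open>Convergence of the scaled centred sums\<close>

lemma centred_sum_moments:
  assumes "1 \<le> n"
  shows "integrable M (\<lambda>\<omega>. (centred_sum d n \<omega>)\<^sup>2)"
    and "expectation (\<lambda>\<omega>. (centred_sum d n \<omega>)\<^sup>2) \<le> noise_bound (drift d) 1 n"
  using noise_sum_moments[of 1 n "drift d"] assms by (simp_all add: centred_sum_eq_noise_sum)

text \<open>
  In the block of \<open>q\<close>, \<open>Y q\<close> dominates all the scaled squares and has expectation of order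
  \<open>q powr (- 1 - \<delta>)\<close>. Dividing \<open>(centred_sum d (q\<^sup>2))\<^sup>2\<close> by the bound \<open>V q\<close> of its expectation
  makes the domination uniform: the factors \<open>\<alpha> k\<close> may vary arbitrarily within the block, but
  \<open>(\<alpha> k)\<^sup>2 * V q / k\<^sup>2\<close> has a common bound. The fresh noise is summed over the block.
\<close>

lemma AE_scaled_centred_sum_tendsto_0:
  fixes \<alpha> d :: "nat \<Rightarrow> real" and \<nu> \<delta> C1 C2 :: real
  assumes d: "\<And>j. j \<ge> 1 \<Longrightarrow> d j > 0" and L: "1 \<le> L"
    and \<delta>: "\<delta> > 0" "\<nu> = (1 - \<delta>) / 2"
    and C1: "\<And>k. k \<ge> L \<Longrightarrow> (\<alpha> k)\<^sup>2 / real k powr (2 * \<gamma> + 1 + \<nu>) *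
           (\<Sum>j = L..<k. (d j)\<^sup>2 * real j powr (2 * \<gamma>)) \<le> C1"
    and C2: "\<And>k. k \<ge> L \<Longrightarrow> (\<alpha> k)\<^sup>2 / real k powr (1 + \<nu>) *
           (\<Sum>j = L + 1..<k. (\<Sum>i = L..<j. d i) * d j * (1 / real j)) \<le> C2"
  shows "AE \<omega> in M. (\<lambda>k. \<alpha> k * centred_sum d k \<omega> / real k) \<longlonglongrightarrow> 0"
proof -
  obtain C where C: "C > 0"
    and old: "\<And>n k. L \<le> n \<Longrightarrow> n < k \<Longrightarrow> k \<le> 4 * n \<Longrightarrow>
      (\<alpha> k)\<^sup>2 * noise_bound (drift d) 1 n \<le> C * real k powr (1 + \<nu>)"
    and new: "\<And>n k. L \<le> n \<Longrightarrow> n < k \<Longrightarrow> k \<le> 4 * n \<Longrightarrow>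
      (\<alpha> k)\<^sup>2 * noise_bound (drift d) n k \<le> C * real (k - n) * real k powr \<nu>"
    using scaled_noise_bounds[of d L \<alpha> \<nu> C1 C2] d L C1 C2 by blast
  define q1 where "q1 = L + 1"
  define R where "R q k \<omega> = noise_sum \<gamma> (drift d) (q\<^sup>2) k (\<lambda>h. E h \<omega>)" for q k \<omega>
  define V where "V q = noise_bound (drift d) 1 (q\<^sup>2)" for q
  define s where "s q = real q powr (- 1 - \<delta>)" for q
  define Y where "Y q \<omega> = 2 * (C * s q * ((centred_sum d (q\<^sup>2) \<omega>)\<^sup>2 / V q)
      + (\<Sum>k \<in> {q\<^sup>2<..(q + 1)\<^sup>2}. (\<alpha> k)\<^sup>2 / (real k)\<^sup>2 * (R q k \<omega>)\<^sup>2))" for q \<omega>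
  have block: "L \<le> q\<^sup>2" "1 < q\<^sup>2" "1 \<le> q" if "q1 \<le> q" for q
  proof -
    have "q \<le> q\<^sup>2" by (simp add: power2_nat_le_imp_le)
    then show "L \<le> q\<^sup>2" "1 < q\<^sup>2" "1 \<le> q" using that L by (simp_all add: q1_def)
  qed
  have block4: "k \<le> 4 * q\<^sup>2" if "q1 \<le> q" "k \<le> (q + 1)\<^sup>2" for q k
  proof -
    have "(q + 1)\<^sup>2 \<le> (2 * q)\<^sup>2" using block[OF that(1)] by (intro power_mono) auto
    then show ?thesis using that by (simp add: power_mult_distrib)
  qed
  have V: "V q > 0" if "q1 \<le> q" for q
    unfolding V_def by (rule noise_bound_pos) (use d block[OF that] in auto)
  have s_nonneg: "s q \<ge> 0" for q by (simp add: s_def)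
  have powr_q: "real k powr t \<le> real q powr (2 * t)" if "q1 \<le> q" "q\<^sup>2 < k" "t \<le> 0" for q k t
  proof -
    have q: "real q > 0" using block[OF that(1)] by simp
    have "real k powr t \<le> ((real q)\<^sup>2) powr t"
      using that q by (intro powr_mono2') (auto simp flip: of_nat_power)
    also have "(real q)\<^sup>2 = real q powr 2" using q by simp
    finally show ?thesis by (simp only: powr_powr)
  qed
  have R_int: "integrable M (\<lambda>\<omega>. (R q k \<omega>)\<^sup>2)"
    and R_le: "expectation (\<lambda>\<omega>. (R q k \<omega>)\<^sup>2) \<le> noise_bound (drift d) (q\<^sup>2) k"
    if "q1 \<le> q" "q\<^sup>2 < k" for q k
    using noise_sum_moments[of "q\<^sup>2" k "drift d"] block[OF that(1)] that by (simp_all add: R_def)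
  have Y_nonneg: "0 \<le> Y q \<omega>" if "q1 \<le> q" for q \<omega>
    unfolding Y_def using C s_nonneg[of q] V[OF that]
    by (intro mult_nonneg_nonneg add_nonneg_nonneg sum_nonneg divide_nonneg_nonneg) auto
  have S_int: "integrable M (\<lambda>\<omega>. (centred_sum d (q\<^sup>2) \<omega>)\<^sup>2)"
    and S_le: "expectation (\<lambda>\<omega>. (centred_sum d (q\<^sup>2) \<omega>)\<^sup>2) \<le> V q" if "q1 \<le> q" for q
    using centred_sum_moments[of "q\<^sup>2" d] block[OF that] by (simp_all add: V_def)
  have Y_int: "integrable M (Y q)" if "q1 \<le> q" for q
    unfolding Y_def using S_int[OF that] R_int[OF that]
    by (intro integrable_mult_right Bochner_Integration.integrable_add integrable_divide
      Bochner_Integration.integrable_sum) auto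
  have Y_le: "expectation (Y q) \<le> 20 * C * s q" if q: "q1 \<le> q" for q
  proof -
    have exp_eq: "expectation (Y q) = 2 * (C * s q * (expectation (\<lambda>\<omega>. (centred_sum d (q\<^sup>2) \<omega>)\<^sup>2) / V q)
      + (\<Sum>k \<in> {q\<^sup>2<..(q + 1)\<^sup>2}. (\<alpha> k)\<^sup>2 / (real k)\<^sup>2 * expectation (\<lambda>\<omega>. (R q k \<omega>)\<^sup>2)))"
      unfolding Y_def using S_int[OF q] R_int[OF q]
      by (subst integral_mult_right_zero, subst Bochner_Integration.integral_add)
         (auto simp: Bochner_Integration.integral_sum)
    have "C * s q * (expectation (\<lambda>\<omega>. (centred_sum d (q\<^sup>2) \<omega>)\<^sup>2) / V q) \<le> C * s q * 1"
      using S_le[OF q] V[OF q] C s_nonneg by (intro mult_left_mono) auto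
    moreover have "(\<Sum>k \<in> {q\<^sup>2<..(q + 1)\<^sup>2}. (\<alpha> k)\<^sup>2 / (real k)\<^sup>2 * expectation (\<lambda>\<omega>. (R q k \<omega>)\<^sup>2)) \<le> 9 * (C * s q)"
    proof -
      have "(\<alpha> k)\<^sup>2 / (real k)\<^sup>2 * expectation (\<lambda>\<omega>. (R q k \<omega>)\<^sup>2)
          \<le> C * (3 * real q) * real q powr (2 * (\<nu> - 2))" if k: "k \<in> {q\<^sup>2<..(q + 1)\<^sup>2}" for k
      proof -
        have k': "q\<^sup>2 < k" "k \<le> (q + 1)\<^sup>2" "real k > 0" using k by auto
        have "k - q\<^sup>2 \<le> 2 * q + 1" using k' by (simp add: power2_eq_square)
        \<comment> \<open>A block has \<open>2 * q + 1 \<le> 3 * q\<close> elements; this factor enters here and once more in the sum below.\<close>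
        then have len: "real (k - q\<^sup>2) \<le> 3 * real q" using block[OF q] by simp
        have "(\<alpha> k)\<^sup>2 * expectation (\<lambda>\<omega>. (R q k \<omega>)\<^sup>2) \<le> (\<alpha> k)\<^sup>2 * noise_bound (drift d) (q\<^sup>2) k"
          using R_le[OF q k'(1)] by (rule mult_left_mono) simp
        also have "\<dots> \<le> C * real (k - q\<^sup>2) * real k powr \<nu>"
          by (rule new) (use block[OF q] block4[OF q] k' in auto)
        also have "\<dots> \<le> C * (3 * real q) * real k powr \<nu>"
          using len C by (intro mult_right_mono mult_left_mono) auto
        finally have "(\<alpha> k)\<^sup>2 * expectation (\<lambda>\<omega>. (R q k \<omega>)\<^sup>2) / (real k)\<^sup>2
            \<le> C * (3 * real q) * real k powr \<nu> / (real k)\<^sup>2"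
          by (rule divide_right_mono) simp
        also have "\<dots> = C * (3 * real q) * real k powr (\<nu> - 2)"
          using k' by (simp add: powr_diff)
        also have "\<dots> \<le> C * (3 * real q) * real q powr (2 * (\<nu> - 2))"
          using \<delta> C by (intro mult_left_mono powr_q q k') auto
        finally show ?thesis by simp
      qed
      then have "(\<Sum>k \<in> {q\<^sup>2<..(q + 1)\<^sup>2}. (\<alpha> k)\<^sup>2 / (real k)\<^sup>2 * expectation (\<lambda>\<omega>. (R q k \<omega>)\<^sup>2))
          \<le> (\<Sum>k \<in> {q\<^sup>2<..(q + 1)\<^sup>2}. C * (3 * real q) * real q powr (2 * (\<nu> - 2)))"
        by (rule sum_mono)
      also have "\<dots> = real (2 * q + 1) * (C * (3 * real q) * real q powr (2 * (\<nu> - 2)))"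
        by (simp add: power2_eq_square)
      also have "\<dots> \<le> (3 * real q) * (C * (3 * real q) * real q powr (2 * (\<nu> - 2)))"
        using block[OF q] C by (intro mult_right_mono) auto
      also have "\<dots> = 9 * C * (real q powr 2 * real q powr (2 * (\<nu> - 2)))"
        using block[OF q] by (simp add: power2_eq_square)
      also have "real q powr 2 * real q powr (2 * (\<nu> - 2)) = real q powr (2 + 2 * (\<nu> - 2))"
        by (rule powr_add[symmetric])
      also have "2 + 2 * (\<nu> - 2) = - 1 - \<delta>"
        using \<delta> by (simp add: field_simps)
      also have "9 * C * real q powr (- 1 - \<delta>) = 9 * (C * s q)"
        by (simp add: s_def)
      finally show ?thesis .
    qed
    ultimately show ?thesis unfolding exp_eq by simp
  qed
  have "AE \<omega> in M. (\<lambda>q. Y q \<omega>) \<longlonglongrightarrow> 0"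
  proof (rule AE_tendsto_0_if_summable_nn_integral[where N = q1 and u = "\<lambda>q. 20 * C * s q"])
    show "Y q \<in> borel_measurable M" if "q1 \<le> q" for q
      using Y_int[OF that] by (rule borel_measurable_integrable)
    show "(\<integral>\<^sup>+ \<omega>. ennreal (Y q \<omega>) \<partial>M) \<le> ennreal (20 * C * s q)" if "q1 \<le> q" for q
      using Y_int[OF that] Y_nonneg[OF that] Y_le[OF that]
      by (subst nn_integral_eq_integral) (auto intro: ennreal_leI)
    have "summable s"
      unfolding s_def using \<delta> by (subst summable_real_powr_iff) simp
    then show "summable (\<lambda>q. 20 * C * s q)" by (rule summable_mult)
  qed (use Y_nonneg C s_nonneg in auto)
  moreover have "AE \<omega> in M. \<forall>q k. q1 \<le> q \<longrightarrow> q\<^sup>2 < k \<longrightarrow> k \<le> (q + 1)\<^sup>2 \<longrightarrow>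
      (\<alpha> k * centred_sum d k \<omega> / real k)\<^sup>2 \<le> Y q \<omega>"
    using AE_exp_factor_le_1
  proof eventually_elim
    case (elim \<omega>)
    show ?case
    proof (intro allI impI)
      fix q k assume q: "q1 \<le> q" and k: "q\<^sup>2 < k" "k \<le> (q + 1)\<^sup>2"
      define W where "W = exp_factor E \<gamma> (q\<^sup>2) k \<omega>"
      define D where "D = centred_sum d (q\<^sup>2) \<omega>"
      have W: "0 \<le> W" "W \<le> 1"
        using elim block[OF q] by (auto simp: W_def) (auto simp: exp_factor_def)
      have k0: "real k > 0" using k by simp
      have split: "centred_sum d k \<omega> = W * D + R q k \<omega>"
        unfolding W_def D_def R_def using block[OF q] k by (intro centred_sum_restart) auto
      have "(W * D + R q k \<omega>)\<^sup>2 \<le> 2 * (W * D)\<^sup>2 + 2 * (R q k \<omega>)\<^sup>2"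
        using zero_le_power2[of "W * D - R q k \<omega>"] by (simp add: power2_eq_square algebra_simps)
      also have "(W * D)\<^sup>2 \<le> D\<^sup>2"
        unfolding power_mult_distrib using W by (intro mult_left_le_one_le) (auto simp: power_le_one)
      finally have "(centred_sum d k \<omega>)\<^sup>2 \<le> 2 * D\<^sup>2 + 2 * (R q k \<omega>)\<^sup>2"
        unfolding split by simp
      then have "(\<alpha> k)\<^sup>2 / (real k)\<^sup>2 * (centred_sum d k \<omega>)\<^sup>2
          \<le> (\<alpha> k)\<^sup>2 / (real k)\<^sup>2 * (2 * D\<^sup>2 + 2 * (R q k \<omega>)\<^sup>2)"
        by (rule mult_left_mono) simp
      then have "(\<alpha> k * centred_sum d k \<omega> / real k)\<^sup>2
          \<le> 2 * ((\<alpha> k)\<^sup>2 / (real k)\<^sup>2 * D\<^sup>2 + (\<alpha> k)\<^sup>2 / (real k)\<^sup>2 * (R q k \<omega>)\<^sup>2)"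
        by (simp add: power_divide power_mult_distrib algebra_simps)
      also have "(\<alpha> k)\<^sup>2 / (real k)\<^sup>2 * D\<^sup>2 \<le> C * s q * (D\<^sup>2 / V q)"
      proof -
        have "(\<alpha> k)\<^sup>2 * V q \<le> C * real k powr (1 + \<nu>)"
          unfolding V_def by (rule old) (use block[OF q] block4[OF q] k in auto)
        then have "(\<alpha> k)\<^sup>2 * V q / (real k)\<^sup>2 \<le> C * real k powr (1 + \<nu>) / (real k)\<^sup>2"
          by (rule divide_right_mono) simp
        also have "\<dots> = C * real k powr (1 + \<nu> - 2)"
          using k0 by (simp add: powr_diff powr_add power2_eq_square)
        also have "\<dots> \<le> C * real q powr (2 * (1 + \<nu> - 2))"
          using \<delta> C by (intro mult_left_mono powr_q q k) auto
        also have "2 * (1 + \<nu> - 2) = - 1 - \<delta>" using \<delta> by (simp add: field_simps)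
        finally have "(\<alpha> k)\<^sup>2 * V q / (real k)\<^sup>2 \<le> C * s q" by (simp add: s_def)
        then have "(\<alpha> k)\<^sup>2 * V q / (real k)\<^sup>2 * (D\<^sup>2 / V q) \<le> C * s q * (D\<^sup>2 / V q)"
          using V[OF q] by (intro mult_right_mono) auto
        then show ?thesis using V[OF q] by simp
      qed
      also have "(\<alpha> k)\<^sup>2 / (real k)\<^sup>2 * (R q k \<omega>)\<^sup>2
          \<le> (\<Sum>k \<in> {q\<^sup>2<..(q + 1)\<^sup>2}. (\<alpha> k)\<^sup>2 / (real k)\<^sup>2 * (R q k \<omega>)\<^sup>2)"
        by (rule member_le_sum[where f = "\<lambda>k. (\<alpha> k)\<^sup>2 / (real k)\<^sup>2 * (R q k \<omega>)\<^sup>2"]) (use k in auto)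
      finally show "(\<alpha> k * centred_sum d k \<omega> / real k)\<^sup>2 \<le> Y q \<omega>"
        by (simp add: Y_def D_def)
    qed
  qed
  ultimately show ?thesis
  proof eventually_elim
    case (elim \<omega>)
    show ?case by (rule tendsto_0_if_blockwise_le[OF elim(1), of q1]) (use elim(2) in blast)
  qed
qed

end

theorem proposition2:
  fixes M :: "'a measure"
    and E :: "nat \<Rightarrow> 'a \<Rightarrow> real"
    and f \<alpha> :: "nat \<Rightarrow> real"
    and \<gamma> \<delta> \<nu> :: real
    and L q0 :: nat
  assumes "prob_space M"
    and "prob_space.indep_vars M (\<lambda>_. borel) E {1..}"
    and "\<And>h. h \<ge> 1 \<Longrightarrow> distributed M lborel (E h) (exponential_density 1)"
    and "\<gamma> > 0"
    and "strict_mono f" and "f 0 = 0"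
    and "\<And>k. k \<ge> 1 \<Longrightarrow> \<alpha> k > 0"
    and "0 < \<delta>" and "\<delta> < 3" and "\<nu> = (1 - \<delta>) / 2"
    and "L \<ge> 1"
    and "bdd_above ((\<lambda>k. (\<alpha> k)\<^sup>2 / real k powr (2 * \<gamma> + 1 + \<nu>) *
           (\<Sum>j = L..<k. (increment f j)\<^sup>2 * real j powr (2 * \<gamma>))) ` {L..})"
    and "bdd_above ((\<lambda>k. (\<alpha> k)\<^sup>2 / real k powr (1 + \<nu>) *
           (\<Sum>j = L + 1..<k. (\<Sum>i = L..<j. increment f i) * increment f j * (1 / real j))) ` {L..})"
    and "bdd_above ((\<lambda>k. (\<alpha> k)\<^sup>2 / real k powr (1 + \<nu>) *
           (\<Sum>j = L..<k. increment f j / real j)) ` {L..})"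
    and "bdd_above ((\<lambda>(k, q). 1 / real q powr (3 - \<delta>) *
           (\<Sum>i = 1..2 * q + 1. (\<alpha> k)\<^sup>2 * (increment f (q\<^sup>2 + i))\<^sup>2 *
              (real (q\<^sup>2 + i) / real k) powr (2 * \<gamma>))) ` block_pairs L q0)"
    and "bdd_above ((\<lambda>(k, q). (\<alpha> k)\<^sup>2 / real q powr (3 - \<delta>) *
           (\<Sum>j = 2..2 * q + 1. (\<Sum>i = 1..<j. increment f (q\<^sup>2 + i)) * increment f (q\<^sup>2 + j) *
              (1 / real (q\<^sup>2 + j)))) ` block_pairs L q0)"
  shows "(AE \<omega> in M. (\<lambda>k. S_star M E \<gamma> f \<alpha> k \<omega> / real k) \<longlonglongrightarrow> 0) \<and>
    (\<forall>\<mu> :: real. (\<lambda>k. mu_seq M E \<gamma> f \<alpha> k / real k) \<longlonglongrightarrow> \<mu> \<longrightarrow>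
      (AE \<omega> in M. (\<lambda>k. (\<Sum>j = 1..<k. \<alpha> k * increment f j * exp_factor E \<gamma> j k \<omega>) / real k) \<longlonglongrightarrow> \<mu>))"
proof -
  interpret exponential_sequence M E \<gamma>
    using assms(1-4) by (simp add: exponential_sequence_def exponential_sequence_axioms_def)
  have d: "increment f j > 0" if "j \<ge> 1" for j
    using \<open>strict_mono f\<close> that by (simp add: increment_def strict_mono_def)
  obtain C1 where C1: "\<And>k. k \<ge> L \<Longrightarrow> (\<alpha> k)\<^sup>2 / real k powr (2 * \<gamma> + 1 + \<nu>) *
      (\<Sum>j = L..<k. (increment f j)\<^sup>2 * real j powr (2 * \<gamma>)) \<le> C1"
    using assms(12) unfolding bdd_above_def by auto
  obtain C2 where C2: "\<And>k. k \<ge> L \<Longrightarrow> (\<alpha> k)\<^sup>2 / real k powr (1 + \<nu>) *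
      (\<Sum>j = L + 1..<k. (\<Sum>i = L..<j. increment f i) * increment f j * (1 / real j)) \<le> C2"
    using assms(13) unfolding bdd_above_def by auto
  have S_eq: "S_star M E \<gamma> f \<alpha> k \<omega> = \<alpha> k * centred_sum (increment f) k \<omega>" for k \<omega>
    by (simp add: S_star_def centred_sum_def sum_distrib_left mult_ac)
  have S: "AE \<omega> in M. (\<lambda>k. S_star M E \<gamma> f \<alpha> k \<omega> / real k) \<longlonglongrightarrow> 0"
    unfolding S_eq
    by (rule AE_scaled_centred_sum_tendsto_0[OF d \<open>L \<ge> 1\<close> \<open>0 < \<delta>\<close> \<open>\<nu> = (1 - \<delta>) / 2\<close> C1 C2])
  have split: "(\<Sum>j = 1..<k. \<alpha> k * increment f j * exp_factor E \<gamma> j k \<omega>)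
      = S_star M E \<gamma> f \<alpha> k \<omega> + mu_seq M E \<gamma> f \<alpha> k" for k \<omega>
    by (simp add: S_star_def mu_seq_def algebra_simps flip: sum.distrib)
  have "AE \<omega> in M. (\<lambda>k. (\<Sum>j = 1..<k. \<alpha> k * increment f j * exp_factor E \<gamma> j k \<omega>) / real k) \<longlonglongrightarrow> \<mu>"
    if \<mu>: "(\<lambda>k. mu_seq M E \<gamma> f \<alpha> k / real k) \<longlonglongrightarrow> \<mu>" for \<mu> :: real
    using S
  proof eventually_elim
    case (elim \<omega>)
    then show ?case
      unfolding split add_divide_distrib using tendsto_add[OF elim \<mu>] by simp
  qed
  then show ?thesis using S by blast
qed

end
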